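(* If $A$ is a finite-dimensional solvable Lie algebra over a linearly ordered field $\mathbb{F}$, then the partial order rank of $A$ is equal to the rank of $A$, i.e. to the common dimension of the Cartan subalgebras of $A$.
   Context: A partially ordered algebra over a linearly ordered field $\mathbb{F}$ is an algebra $A$ with a partial order making $A$ a partially ordered vector space (compatible with addition and with multiplication by nonnegative scalars) such that $a>0$ implies $ab<a$ and $ba<a$ for all $b\in A$. For Lie algebras $ab$ denotes the Lie bracket. A partial order of this kind on $A$ is maximal if no other such partial order on $A$ properly refines (extends) it. An ideal $I$ is convex if $0\le b\le a\in I$ implies $b\in I$; then $A/I$ has the induced partial order: $x+I\le y+I$ iff $a\le b$ for some $a\in x+I$, $b\in y+I$. Let $0=I_0<I_1<\dots<I_s=A$ be a series of ideals. The factor $I_{j}/I_{j-1}$ is central if it annihilates $A/I_{j-1}$ (all products of its elements with elements of $A/I_{j-1}$, on either side, are zero), and chief if it is a minimal nonzero ideal of $A/I_{j-1}$. The partial order on $A$ is lexicographic with respect to a series of convex ideals if for all $x\ne y$ and the maximal $k$ with $x+I_k\ne y+I_k$, $x$ and $y$ are related (less, greater or incomparable) exactly as $x+I_k$ and $y+I_k$ are in $A/I_k$. For every maximal partial order on a finite-dimensional algebra $A$ over a linearly ordered field there is a finite series of convex ideals such that each factor is either central with linear induced order, or a noncentral chief factor with trivial induced order, and the order is lexicographic with respect to this series. The rank of the maximal partial order is the sum of the dimensions of the central factors of such a series. It does not depend on the series nor on the maximal order; the common value is the partial order rank of $A$. A Cartan subalgebra is a nilpotent subalgebra equal to its own normalizer.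 *)

theory Defs
  imports Complex_Main "HOL-Library.Set_Algebras"
begin

text \<open>
  The algebra \<open>A\<close> is the whole type \<open>'a\<close>; ideals and subalgebras are sets.  For an ideal \<open>I\<close>, the
  quotient \<open>A/I\<close> is represented by the cosets \<open>x +o I\<close>, with zero element \<open>I\<close>.
\<close>

locale fin_dim_algebra = finite_dimensional_vector_space scale Basis
  for scale :: "'f::linordered_field \<Rightarrow> 'a::ab_group_add \<Rightarrow> 'a" (infixr \<open>*s\<close> 75)
    and Basis :: "'a set" +
  fixes mult :: "'a \<Rightarrow> 'a \<Rightarrow> 'a" (infixl \<open>\<cdot>\<close> 72)
  assumes linear_right: "\<And>a. Vector_Spaces.linear scale scale (\<lambda>b. a \<cdot> b)"
    and linear_left: "\<And>b. Vector_Spaces.linear scale scale (\<lambda>a. a \<cdot> b)"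
begin

definition po_algebra :: "'a rel \<Rightarrow> bool" where
  "po_algebra r \<longleftrightarrow> partial_order_on UNIV r
     \<and> (\<forall>x y z. (x, y) \<in> r \<longrightarrow> (x + z, y + z) \<in> r)
     \<and> (\<forall>c x y. 0 \<le> c \<and> (x, y) \<in> r \<longrightarrow> (c *s x, c *s y) \<in> r)
     \<and> (\<forall>a b. (0, a) \<in> r - Id \<longrightarrow> (a \<cdot> b, a) \<in> r - Id \<and> (b \<cdot> a, a) \<in> r - Id)"

definition maximal_order :: "'a rel \<Rightarrow> bool" where
  "maximal_order r \<longleftrightarrow> po_algebra r \<and> (\<forall>r'. po_algebra r' \<and> r \<subseteq> r' \<longrightarrow> r' = r)"

definition ideal :: "'a set \<Rightarrow> bool" where
  "ideal I \<longleftrightarrow> subspace I \<and> (\<forall>x\<in>I. \<forall>y. x \<cdot> y \<in> I \<and> y \<cdot> x \<in> I)"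

definition convex_ideal :: "'a rel \<Rightarrow> 'a set \<Rightarrow> bool" where
  "convex_ideal r I \<longleftrightarrow> ideal I \<and> (\<forall>a\<in>I. \<forall>b. (0, b) \<in> r \<and> (b, a) \<in> r \<longrightarrow> b \<in> I)"

definition quotient_order :: "'a rel \<Rightarrow> 'a set \<Rightarrow> 'a set rel" where
  "quotient_order r I = {(x +o I, y +o I) | x y. \<exists>a\<in>x +o I. \<exists>b\<in>y +o I. (a, b) \<in> r}"

definition factor :: "'a set \<Rightarrow> 'a set \<Rightarrow> 'a set set" where
  "factor J I = (\<lambda>x. x +o I) ` J"

definition factor_order :: "'a rel \<Rightarrow> 'a set \<Rightarrow> 'a set \<Rightarrow> 'a set rel" where
  "factor_order r J I = Restr (quotient_order r I) (factor J I)"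

definition factor_dim :: "'a set \<Rightarrow> 'a set \<Rightarrow> nat" where
  "factor_dim J I = dim J - dim I"

text \<open>Ideals of the algebra \<open>A/I\<close>, whose operations are given by coset representatives.\<close>

definition quotient_ideal :: "'a set \<Rightarrow> 'a set set \<Rightarrow> bool" where
  "quotient_ideal I Q \<longleftrightarrow> Q \<subseteq> factor UNIV I \<and> I \<in> Q
     \<and> (\<forall>x y. x +o I \<in> Q \<and> y +o I \<in> Q \<longrightarrow> (x + y) +o I \<in> Q)
     \<and> (\<forall>c x. x +o I \<in> Q \<longrightarrow> (c *s x) +o I \<in> Q)
     \<and> (\<forall>x y. x +o I \<in> Q \<longrightarrow> (x \<cdot> y) +o I \<in> Q \<and> (y \<cdot> x) +o I \<in> Q)"

definition central_factor :: "'a set \<Rightarrow> 'a set \<Rightarrow> bool" where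
  "central_factor J I \<longleftrightarrow> (\<forall>x\<in>J. \<forall>y. (x \<cdot> y) +o I = I \<and> (y \<cdot> x) +o I = I)"

definition chief_factor :: "'a set \<Rightarrow> 'a set \<Rightarrow> bool" where
  "chief_factor J I \<longleftrightarrow> quotient_ideal I (factor J I) \<and> factor J I \<noteq> {I}
     \<and> (\<forall>Q. quotient_ideal I Q \<and> Q \<noteq> {I} \<and> Q \<subseteq> factor J I \<longrightarrow> Q = factor J I)"

text \<open>
  The order is lexicographic for the series \<open>S 0, \<dots>, S s\<close>.  Since \<open>x\<close> and \<open>y\<close> range over all ordered
  pairs, the equivalence below also covers ``greater'' and ``incomparable''.
\<close>

definition lexicographic :: "'a rel \<Rightarrow> nat \<Rightarrow> (nat \<Rightarrow> 'a set) \<Rightarrow> bool" where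
  "lexicographic r s S \<longleftrightarrow> (\<forall>x y k. x \<noteq> y \<and> k \<le> s \<and> x +o S k \<noteq> y +o S k
      \<and> (\<forall>j. k < j \<and> j \<le> s \<longrightarrow> x +o S j = y +o S j)
      \<longrightarrow> ((x, y) \<in> r \<longleftrightarrow> (x +o S k, y +o S k) \<in> quotient_order r (S k)))"

definition adapted_series :: "'a rel \<Rightarrow> nat \<Rightarrow> (nat \<Rightarrow> 'a set) \<Rightarrow> bool" where
  "adapted_series r s S \<longleftrightarrow> S 0 = {0} \<and> S s = UNIV
     \<and> (\<forall>j\<le>s. convex_ideal r (S j))
     \<and> (\<forall>j<s. S j \<subset> S (Suc j))
     \<and> (\<forall>j<s. central_factor (S (Suc j)) (S j)
            \<and> linear_order_on (factor (S (Suc j)) (S j)) (factor_order r (S (Suc j)) (S j))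
          \<or> \<not> central_factor (S (Suc j)) (S j) \<and> chief_factor (S (Suc j)) (S j)
            \<and> factor_order r (S (Suc j)) (S j) = Id_on (factor (S (Suc j)) (S j)))
     \<and> lexicographic r s S"

definition central_dim :: "nat \<Rightarrow> (nat \<Rightarrow> 'a set) \<Rightarrow> nat" where
  "central_dim s S =
     (\<Sum>j | j < s \<and> central_factor (S (Suc j)) (S j). factor_dim (S (Suc j)) (S j))"

text \<open>
  The ranks below are numbers that are well defined only by virtue of a theorem (existence of the
  objects involved and independence of the choices).  The relations ``\<open>n\<close> is the rank'' therefore
  include both existence and independence; in particular such an \<open>n\<close> is unique.
\<close>

definition is_rank_of_order :: "'a rel \<Rightarrow> nat \<Rightarrow> bool" where
  "is_rank_of_order r n \<longleftrightarrow> (\<exists>s S. adapted_series r s S)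
     \<and> (\<forall>s S. adapted_series r s S \<longrightarrow> central_dim s S = n)"

definition is_partial_order_rank :: "nat \<Rightarrow> bool" where
  "is_partial_order_rank n \<longleftrightarrow> (\<exists>r. maximal_order r)
     \<and> (\<forall>r. maximal_order r \<longrightarrow> is_rank_of_order r n)"

end

locale fin_dim_lie_algebra = fin_dim_algebra scale Basis bracket
  for scale :: "'f::linordered_field \<Rightarrow> 'a::ab_group_add \<Rightarrow> 'a" (infixr \<open>*s\<close> 75)
    and Basis :: "'a set"
    and bracket :: "'a \<Rightarrow> 'a \<Rightarrow> 'a" +
  assumes alternating: "bracket x x = 0"
    and jacobi: "bracket x (bracket y z) + bracket y (bracket z x) + bracket z (bracket x y) = 0"
begin

definition bracket_span :: "'a set \<Rightarrow> 'a set \<Rightarrow> 'a set" where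
  "bracket_span U V = span {bracket x y | x y. x \<in> U \<and> y \<in> V}"

definition solvable :: bool where
  "solvable \<longleftrightarrow> (\<exists>n. ((\<lambda>U. bracket_span U U) ^^ n) UNIV = {0})"

definition subalgebra :: "'a set \<Rightarrow> bool" where
  "subalgebra H \<longleftrightarrow> subspace H \<and> (\<forall>x\<in>H. \<forall>y\<in>H. bracket x y \<in> H)"

definition nilpotent :: "'a set \<Rightarrow> bool" where
  "nilpotent H \<longleftrightarrow> (\<exists>n. (bracket_span H ^^ n) H = {0})"

definition normalizer :: "'a set \<Rightarrow> 'a set" where
  "normalizer H = {x. \<forall>y\<in>H. bracket x y \<in> H}"

definition cartan_subalgebra :: "'a set \<Rightarrow> bool" where
  "cartan_subalgebra H \<longleftrightarrow> subalgebra H \<and> nilpotent H \<and> normalizer H = H"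

definition is_rank :: "nat \<Rightarrow> bool" where
  "is_rank n \<longleftrightarrow> (\<exists>H. cartan_subalgebra H) \<and> (\<forall>H. cartan_subalgebra H \<longrightarrow> dim H = n)"

end

end

(*
  Orders.  A compatible order is given by its cone P of nonnegative elements.  A cone Q containing P
  and closed under x |-> x + x b, x + b x need not be pointed, but adding to P the elements of Q
  outside its lineality space extends the order; if P is maximal, these elements already lie in P.
  With Q = P + I this shows that the order is lexicographic for every convex ideal I, and with
  Q = P + F>=0 z + I that an element z central modulo I is comparable to 0.  Given a convex ideal
  I, let K be a minimal larger convex ideal.  If P meets K only in I, every ideal between I and K
  is convex, so K/I is chief.  Otherwise each a in P and K outside I is central modulo I, because the
  convex ideal of all x infinitesimal with respect to a contains [a, A] but not a.

  Cartan subalgebras.  In a solvable Lie algebra in characteristic 0, [A, A] acts trivially on chief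
  factors, so an element h acts on a noncentral chief factor either as 0 or injectively.  For every
  Cartan subalgebra H a suitable h in H has H as the Fitting null component of ad h; as
  A = H + [h, A], this h acts injectively on every noncentral chief factor.  Hence dim H is the
  sum of the dimensions of the central factors.
*)

theory Submission
  imports Defs "HOL-Computational_Algebra.Polynomial"
begin

section \<open>Polynomials in an endomorphism and the Fitting decomposition\<close>

context finite_dimensional_vector_space
begin

lemma linear_endoE:
  assumes "Vector_Spaces.linear scale scale T"
  shows "T (x + y) = T x + T y" "T (x - y) = T x - T y" "T (- x) = - T x"
    "T 0 = 0" "T (c *s x) = c *s T x"
proof -
  interpret T: Vector_Spaces.linear scale scale T by fact
  show "T (x + y) = T x + T y" "T (x - y) = T x - T y" "T (- x) = - T x"
    "T 0 = 0" "T (c *s x) = c *s T x"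
    by (simp_all add: T.add T.diff T.neg T.zero T.scale)
qed

lemma linear_endo_image_subspace:
  assumes "Vector_Spaces.linear scale scale T" "subspace W"
  shows "subspace (T ` W)"
proof -
  interpret T: Vector_Spaces.linear scale scale T by fact
  show ?thesis using assms(2) by (rule T.subspace_image)
qed

lemma linear_endo_funpow:
  assumes "Vector_Spaces.linear scale scale T"
  shows "Vector_Spaces.linear scale scale (T ^^ n)"
proof (induction n)
  case 0
  show ?case using linear_id by (simp add: id_def)
next
  case (Suc n)
  show ?case using Vector_Spaces.linear_compose[OF Suc assms] by (simp add: o_def)
qed

text \<open>This is the vector \<open>p(T) m\<close>, evaluated by Horner's scheme so that proofs
  can go by induction over \<open>pCons\<close>.\<close>

definition poly_op :: "('b \<Rightarrow> 'b) \<Rightarrow> 'a poly \<Rightarrow> 'b \<Rightarrow> 'b" where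
  "poly_op T p m = fold_coeffs (\<lambda>c v. c *s m + T v) p 0"

context
  fixes T :: "'b \<Rightarrow> 'b"
  assumes T: "Vector_Spaces.linear scale scale T"
begin

lemma poly_op_0 [simp]: "poly_op T 0 m = 0"
  by (simp add: poly_op_def)

lemma poly_op_pCons [simp]: "poly_op T (pCons c p) m = c *s m + T (poly_op T p m)"
  by (cases "p = 0 \<and> c = 0") (auto simp: poly_op_def linear_endoE[OF T])

lemma poly_op_add: "poly_op T (p + q) m = poly_op T p m + poly_op T q m"
  by (induction p q rule: poly_induct2) (auto simp: linear_endoE[OF T] scale_left_distrib)

lemma poly_op_smult: "poly_op T (smult c p) m = c *s poly_op T p m"
  by (induction p) (auto simp: linear_endoE[OF T] scale_right_distrib)

lemma poly_op_diff: "poly_op T (p - q) m = poly_op T p m - poly_op T q m"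
  using poly_op_add[of "p - q" q m] by (simp add: algebra_simps)

lemma poly_op_add_right: "poly_op T p (x + y) = poly_op T p x + poly_op T p y"
  by (induction p) (auto simp: linear_endoE[OF T] scale_right_distrib algebra_simps)

lemma poly_op_scale_right: "poly_op T p (c *s x) = c *s poly_op T p x"
  by (induction p) (auto simp: linear_endoE[OF T] scale_right_distrib mult.commute)

lemma linear_poly_op: "Vector_Spaces.linear scale scale (poly_op T p)"
  by (intro Vector_Spaces.linear_iff[THEN iffD2] conjI allI vector_space_axioms
      poly_op_add_right poly_op_scale_right)

lemma poly_op_mult: "poly_op T (p * q) m = poly_op T p (poly_op T q m)"
  by (induction p) (auto simp: poly_op_add poly_op_smult)

lemma poly_op_mem:
  assumes "subspace J" "\<And>m. m \<in> J \<Longrightarrow> T m \<in> J" "m \<in> J"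
  shows "poly_op T p m \<in> J"
  using assms by (induction p) (auto intro!: subspace_add subspace_scale subspace_0)

text \<open>The vectors \<open>p(T) m\<close> with \<open>p\<close> of degree below \<open>n\<close>
  form a space that grows with \<open>n\<close> inside a finite-dimensional one. Two consecutive
  spaces therefore coincide, and some \<open>T^N m\<close> is a combination of lower powers.\<close>

lemma local_annihilating_poly: "\<exists>p. p \<noteq> 0 \<and> poly_op T p m = 0"
proof -
  define V where "V n = (\<lambda>p. poly_op T p m) ` {p. \<forall>i\<ge>n. coeff p i = 0}" for n
  have sub: "subspace (V n)" for n
    unfolding subspace_def
  proof (intro conjI ballI allI)
    show "0 \<in> V n" unfolding V_def by (rule image_eqI[of _ _ 0]) auto
  next
    fix x y assume "x \<in> V n" "y \<in> V n"
    then obtain p q where "x = poly_op T p m" "y = poly_op T q m"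
      "\<forall>i\<ge>n. coeff p i = 0" "\<forall>i\<ge>n. coeff q i = 0" unfolding V_def by auto
    then show "x + y \<in> V n"
      unfolding V_def by (intro image_eqI[of _ _ "p + q"]) (auto simp: poly_op_add)
  next
    fix c x assume "x \<in> V n"
    then obtain p where "x = poly_op T p m" "\<forall>i\<ge>n. coeff p i = 0" unfolding V_def by auto
    then show "c *s x \<in> V n"
      unfolding V_def by (intro image_eqI[of _ _ "smult c p"]) (auto simp: poly_op_smult)
  qed
  have "\<exists>N. \<forall>n. dim (V n) \<le> dim (V N)"
    using ex_has_greatest_nat[of "\<lambda>_. True" 0 "\<lambda>n. dim (V n)" "Suc dimension"] dim_subset_UNIV
    by (auto simp: less_Suc_eq_le)
  then obtain N where N: "dim (V (Suc N)) \<le> dim (V N)" by blast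
  have "V N \<subseteq> V (Suc N)" unfolding V_def by auto
  then have eq: "V N = V (Suc N)" using subspace_dim_equal[OF sub sub] N by blast
  have "poly_op T (monom 1 N) m \<in> V (Suc N)" unfolding V_def by auto
  then obtain q where q: "poly_op T (monom 1 N) m = poly_op T q m" "\<forall>i\<ge>N. coeff q i = 0"
    unfolding eq[symmetric] by (auto simp: V_def)
  have "coeff (monom 1 N - q) N \<noteq> 0" using q(2) by simp
  then have "monom 1 N - q \<noteq> 0" by force
  moreover have "poly_op T (monom 1 N - q) m = 0" using q(1) by (simp add: poly_op_diff)
  ultimately show ?thesis by blast
qed

text \<open>The product of the local annihilators of the basis vectors kills the basis, hence
  everything.\<close>

lemma annihilating_poly: "\<exists>p. p \<noteq> 0 \<and> (\<forall>m. poly_op T p m = 0)"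
proof -
  obtain f where f: "\<And>m. f m \<noteq> 0" "\<And>m. poly_op T (f m) m = 0"
    using local_annihilating_poly by metis
  define p where "p = (\<Prod>b\<in>Basis. f b)"
  have "p \<noteq> 0" using f(1) finite_Basis by (simp add: p_def)
  moreover have "poly_op T p m = 0" for m
  proof -
    interpret P: Vector_Spaces.linear scale scale "poly_op T p" by (rule linear_poly_op)
    have "poly_op T p b = 0" if "b \<in> Basis" for b
    proof -
      \<comment> \<open>The factor belonging to \<open>b\<close> is moved to the right, where it
        acts on \<open>b\<close> first.\<close>
      have "p = (\<Prod>b\<in>Basis - {b}. f b) * f b"
        unfolding p_def using that finite_Basis by (simp add: prod.remove mult.commute)
      then show ?thesis by (simp add: poly_op_mult f(2) linear_endoE(4)[OF linear_poly_op])
    qed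
    then show ?thesis using P.eq_0_on_span[of Basis m] span_Basis by auto
  qed
  ultimately show ?thesis by blast
qed

end

text \<open>For some \<open>N\<close>, the images of \<open>W\<close> under \<open>T^N\<close> and
  \<open>T^(N+1)\<close> agree because dimensions cannot drop forever. Then
  \<open>T^N x = T^(N+1) y\<close> with \<open>y\<close> in \<open>W\<close>, and \<open>T^N\<close>
  kills \<open>x - T y\<close>.\<close>

lemma fitting_decomposition:
  assumes T: "Vector_Spaces.linear scale scale T" and W: "subspace W"
    and TW: "\<And>x. x \<in> W \<Longrightarrow> T x \<in> W" and x: "x \<in> W"
  shows "\<exists>b y n. b \<in> W \<and> (T ^^ n) b = 0 \<and> y \<in> W \<and> x = b + T y"
proof -
  have "\<exists>N. \<forall>n. dim ((T ^^ N) ` W) \<le> dim ((T ^^ n) ` W)"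
    using ex_has_least_nat[of "\<lambda>_. True" 0 "\<lambda>n. dim ((T ^^ n) ` W)"] by auto
  then obtain N where N: "dim ((T ^^ N) ` W) \<le> dim ((T ^^ Suc N) ` W)" by blast
  have "(T ^^ Suc N) ` W \<subseteq> (T ^^ N) ` W"
    using TW by (auto simp: funpow_Suc_right simp del: funpow.simps)
  then have "(T ^^ Suc N) ` W = (T ^^ N) ` W"
    using N linear_endo_image_subspace[OF linear_endo_funpow[OF T] W] by (intro subspace_dim_equal)
  then obtain y where y: "y \<in> W" "(T ^^ N) x = (T ^^ Suc N) y" using x by blast
  then have "(T ^^ N) (x - T y) = 0"
    using linear_endoE[OF linear_endo_funpow[OF T, of N]]
    by (simp add: funpow_Suc_right del: funpow.simps)
  moreover have "x - T y \<in> W" using x TW[OF y(1)] W by (intro subspace_diff)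
  ultimately show ?thesis using y(1) by (intro exI[of _ "x - T y"] exI[of _ y]) auto
qed

end

section \<open>Commutators of endomorphisms in characteristic 0\<close>

locale fin_dim_space_char_0 = finite_dimensional_vector_space scale Basis
  for scale :: "'f::field_char_0 \<Rightarrow> 'a::ab_group_add \<Rightarrow> 'a" (infixr \<open>*s\<close> 75)
    and Basis :: "'a set"
begin

text \<open>Modulo \<open>I\<close>, the relation \<open>[a, d] = u\<close> with \<open>u\<close> commuting with \<open>d\<close> gives \<open>[a, p(d)] = p'(d) u\<close>.
  If \<open>p\<close> has minimal degree with \<open>p(d) = 0\<close>, then \<open>p'(d) u = 0\<close>, so \<open>u\<close> cannot be injective.\<close>

lemma commutator_not_injective_mod:
  assumes a: "Vector_Spaces.linear scale scale a" and d: "Vector_Spaces.linear scale scale d"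
    and I: "subspace I" and J: "subspace J"
    and ideals: "\<And>m. m \<in> I \<Longrightarrow> a m \<in> I" "\<And>m. m \<in> I \<Longrightarrow> d m \<in> I"
      "\<And>m. m \<in> J \<Longrightarrow> a m \<in> J" "\<And>m. m \<in> J \<Longrightarrow> d m \<in> J"
    and u: "\<And>m. u m = a (d m) - d (a m)"
    and comm: "\<And>m. m \<in> J \<Longrightarrow> d (u m) - u (d m) \<in> I"
    and "\<not> J \<subseteq> I"
  shows "\<exists>m\<in>J. m \<notin> I \<and> u m \<in> I"
proof (rule ccontr)
  assume "\<not> ?thesis"
  then have inj: "m \<in> I" if "m \<in> J" "u m \<in> I" for m using that by blast
  note la = linear_endoE[OF a] and ld = linear_endoE[OF d]
  have lin_u: "Vector_Spaces.linear scale scale u"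
    by (intro Vector_Spaces.linear_iff[THEN iffD2] conjI allI vector_space_axioms)
      (auto simp: u la ld scale_right_diff_distrib)
  note lu = linear_endoE[OF lin_u]
  have uJ: "u m \<in> J" if "m \<in> J" for m using that ideals J by (auto simp: u intro: subspace_diff)
  \<comment> \<open>Modulo \<open>I\<close>, the map \<open>u\<close> commutes with every polynomial
    in \<open>d\<close>.\<close>
  have comm_poly: "poly_op d p (u m) - u (poly_op d p m) \<in> I" if "m \<in> J" for p m
  proof (induction p)
    case 0
    then show ?case using I by (simp add: d lu subspace_0)
  next
    case (pCons c p)
    have "poly_op d (pCons c p) (u m) - u (poly_op d (pCons c p) m)
        = d (poly_op d p (u m) - u (poly_op d p m))
          + (d (u (poly_op d p m)) - u (d (poly_op d p m)))"
      by (simp add: d lu ld)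
    moreover have "poly_op d p m \<in> J" using poly_op_mem[OF d J ideals(4) that] by blast
    ultimately show ?case using pCons.IH ideals comm subspace_add[OF I] by simp
  qed
  have deriv: "a (poly_op d p m) - poly_op d p (a m) - poly_op d (pderiv p) (u m) \<in> I"
    if "m \<in> J" for p m
  proof (induction p)
    case 0
    then show ?case using I by (simp add: d la subspace_0)
  next
    case (pCons c p)
    have "a (poly_op d (pCons c p) m) - poly_op d (pCons c p) (a m)
          - poly_op d (pderiv (pCons c p)) (u m)
        = d (a (poly_op d p m) - poly_op d p (a m) - poly_op d (pderiv p) (u m))
          - (poly_op d p (u m) - u (poly_op d p m))"
      by (simp add: d la ld pderiv_pCons poly_op_add u algebra_simps)
    then show ?case using pCons.IH ideals comm_poly[OF that] subspace_diff[OF I] by simp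
  qed
  define kills where "kills p \<longleftrightarrow> p \<noteq> 0 \<and> (\<forall>m\<in>J. poly_op d p m \<in> I)" for p
  obtain p0 where "kills p0" using annihilating_poly[OF d] subspace_0[OF I] by (metis kills_def)
  then obtain p where p: "kills p" and least: "\<And>q. kills q \<Longrightarrow> degree p \<le> degree q"
    using ex_has_least_nat[of kills p0 degree] by blast
  show False
  proof (cases "degree p = 0")
    case True
    then obtain c where c: "p = [:c:]" using degree_eq_zeroE by blast
    have "c \<noteq> 0" using p c by (auto simp: kills_def)
    have "m \<in> I" if "m \<in> J" for m
    proof -
      have "c *s m \<in> I" using p that by (auto simp: kills_def c d ld)
      then have "inverse c *s c *s m \<in> I" by (rule subspace_scale[OF I])
      then show ?thesis using \<open>c \<noteq> 0\<close> by simp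
    qed
    then show False using \<open>\<not> J \<subseteq> I\<close> by blast
  next
    case False
    \<comment> \<open>Here \<open>p'(d) (u m)\<close> lies in \<open>I\<close>; moving
      \<open>u\<close> to the outside lets the assumed injectivity apply.\<close>
    have "poly_op d (pderiv p) m \<in> I" if "m \<in> J" for m
    proof -
      have "a (poly_op d p m) \<in> I" "poly_op d p (a m) \<in> I"
        using p that ideals by (auto simp: kills_def)
      then have "a (poly_op d p m) - poly_op d p (a m) \<in> I" by (rule subspace_diff[OF I])
      from subspace_diff[OF I this deriv[OF that, of p]]
      have "poly_op d (pderiv p) (u m) \<in> I" by simp
      from subspace_diff[OF I this comm_poly[OF that, of "pderiv p"]]
      have "u (poly_op d (pderiv p) m) \<in> I" by simp
      then show ?thesis using inj poly_op_mem[OF d J ideals(4) that] by blast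
    qed
    \<comment> \<open>Characteristic 0 enters here: a nonconstant polynomial has a nonzero
      derivative.\<close>
    moreover have "pderiv p \<noteq> 0" using False by (simp add: pderiv_eq_0_iff)
    ultimately have "degree p \<le> degree (pderiv p)" using least by (simp add: kills_def)
    then show False using False by (simp add: degree_pderiv)
  qed
qed

end

text \<open>A linearly ordered field has characteristic 0.\<close>

sublocale fin_dim_algebra \<subseteq> fin_dim_space_char_0 ..

text \<open>Induction on \<open>F\<close>. If the \<open>h\<close> found for \<open>F\<close> lies
  in the new subspace \<open>C\<close>, take \<open>x\<close> in \<open>H\<close> outside
  \<open>C\<close>. The line \<open>x + t h\<close> misses \<open>C\<close> entirely and meets each
  older subspace at most once, so an infinite field leaves a good \<open>t\<close>.\<close>

lemma (in vector_space) ex_avoiding_subspaces: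
  assumes inf: "infinite (UNIV :: 'a set)" and H: "subspace H" and "finite F"
    and F: "\<And>C. C \<in> F \<Longrightarrow> subspace C" "\<And>C. C \<in> F \<Longrightarrow> \<not> H \<subseteq> C"
  shows "\<exists>h\<in>H. \<forall>C\<in>F. h \<notin> C"
  using \<open>finite F\<close> F
proof (induction F)
  case empty
  then show ?case using subspace_0[OF H] by auto
next
  case (insert C F)
  then obtain h where h: "h \<in> H" "\<forall>C\<in>F. h \<notin> C" by blast
  obtain x where x: "x \<in> H" "x \<notin> C" using insert.prems(2)[of C] by blast
  show ?case
  proof (cases "h \<in> C")
    case False
    then show ?thesis using h by blast
  next
    case True
    define bad where "bad = (\<Union>D\<in>F. {t. x + t *s h \<in> D})"
    have "finite {t. x + t *s h \<in> D}" if D: "D \<in> F" for D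
    proof -
      have "s = t" if "x + s *s h \<in> D" "x + t *s h \<in> D" for s t
      proof (rule ccontr)
        assume "s \<noteq> t"
        have "subspace D" using insert.prems(1) D by blast
        have "(x + s *s h) - (x + t *s h) \<in> D" using that \<open>subspace D\<close> by (intro subspace_diff)
        then have "(s - t) *s h \<in> D" by (simp add: scale_left_diff_distrib)
        then have "inverse (s - t) *s (s - t) *s h \<in> D" by (rule subspace_scale[OF \<open>subspace D\<close>])
        then show False using \<open>s \<noteq> t\<close> h(2) D by simp
      qed
      \<comment> \<open>\<open>SOME\<close> names the only element of this set if there is one; for
        the empty set the inclusion is trivial.\<close>
      then have "{t. x + t *s h \<in> D} \<subseteq> {SOME t. x + t *s h \<in> D}"
        using someI by (metis (mono_tags, lifting) mem_Collect_eq singletonI subsetI)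
      then show ?thesis by (rule finite_subset) simp
    qed
    then have "finite bad" unfolding bad_def using insert.hyps by blast
    then obtain t where t: "t \<notin> bad" using inf ex_new_if_finite by blast
    have "x + t *s h \<notin> C"
    proof
      assume *: "x + t *s h \<in> C"
      have "subspace C" using insert.prems(1) by blast
      from subspace_diff[OF this * subspace_scale[OF this True, of t]] show False using x by simp
    qed
    moreover have "x + t *s h \<in> H" using x h H by (intro subspace_add subspace_scale)
    ultimately show ?thesis using t by (intro bexI[of _ "x + t *s h"]) (auto simp: bad_def)
  qed
qed

section \<open>Ideals, quotients and the cones of partially ordered algebras\<close>

context fin_dim_algebra
begin

lemma mult_simps:
  "(x + y) \<cdot> z = x \<cdot> z + y \<cdot> z" "z \<cdot> (x + y) = z \<cdot> x + z \<cdot> y"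
  "(x - y) \<cdot> z = x \<cdot> z - y \<cdot> z" "z \<cdot> (x - y) = z \<cdot> x - z \<cdot> y"
  "(- x) \<cdot> z = - (x \<cdot> z)" "z \<cdot> (- x) = - (z \<cdot> x)"
  "(c *s x) \<cdot> z = c *s (x \<cdot> z)" "z \<cdot> (c *s x) = c *s (z \<cdot> x)"
  "0 \<cdot> z = 0" "z \<cdot> 0 = 0"
  using linear_endoE[OF linear_left] linear_endoE[OF linear_right] by auto

lemma scale_2: "2 *s x = x + x"
  using scale_left_distrib[of 1 1 x] by simp

lemma idealD:
  assumes "ideal I"
  shows "subspace I" "x \<in> I \<Longrightarrow> x \<cdot> y \<in> I" "x \<in> I \<Longrightarrow> y \<cdot> x \<in> I"
  using assms by (auto simp: ideal_def)

lemma ideal_Int: "ideal I \<Longrightarrow> ideal J \<Longrightarrow> ideal (I \<inter> J)"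
  by (auto simp: ideal_def subspace_inter)

lemma coset_eq_iff:
  assumes "subspace I"
  shows "x +o I = y +o I \<longleftrightarrow> x - y \<in> I"
proof
  assume "x +o I = y +o I"
  moreover have "x \<in> x +o I" using subspace_0[OF assms] by (force simp: elt_set_plus_def)
  ultimately show "x - y \<in> I" by (auto simp: elt_set_plus_def)
next
  have *: "x +o I \<subseteq> y +o I" if "x - y \<in> I" for x y
  proof
    fix z assume "z \<in> x +o I"
    then obtain i where "i \<in> I" "z = x + i" by (auto simp: elt_set_plus_def)
    then have "(x - y) + i \<in> I" "z = y + ((x - y) + i)" using that assms by (auto intro: subspace_add)
    then show "z \<in> y +o I" unfolding elt_set_plus_def by blast
  qed
  assume "x - y \<in> I"
  moreover from this have "y - x \<in> I" using subspace_neg[OF assms] by fastforce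
  ultimately show "x +o I = y +o I" using * by blast
qed

lemma coset_eq_self_iff:
  assumes "subspace I"
  shows "x +o I = I \<longleftrightarrow> x \<in> I"
  using coset_eq_iff[OF assms, of x 0] by (simp add: elt_set_plus_def)

lemma coset_in_factor_iff:
  assumes "subspace I" "subspace J" "I \<subseteq> J"
  shows "x +o I \<in> factor J I \<longleftrightarrow> x \<in> J"
proof
  assume "x +o I \<in> factor J I"
  then obtain y where "y \<in> J" "x - y \<in> I" by (auto simp: factor_def coset_eq_iff[OF assms(1)])
  then show "x \<in> J" using assms subspace_add[of J "x - y" y] by auto
qed (simp add: factor_def)

text \<open>One half of the correspondence theorem: an ideal of \<open>A/I\<close> comes from its
  preimage, an ideal of \<open>A\<close> containing \<open>I\<close>.\<close>

lemma quotient_idealD: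
  assumes Q: "quotient_ideal I Q" and I: "ideal I"
  shows "ideal {x. x +o I \<in> Q}" "I \<subseteq> {x. x +o I \<in> Q}" "Q = factor {x. x +o I \<in> Q} I"
proof -
  have sub: "subspace I" using I by (rule idealD)
  have I_eq: "x +o I = I" if "x \<in> I" for x using that coset_eq_self_iff[OF sub] by blast
  have "I \<in> Q" using Q by (simp add: quotient_ideal_def)
  then have "0 +o I \<in> Q" using I_eq[OF subspace_0[OF sub]] by simp
  then show "ideal {x. x +o I \<in> Q}"
    using Q unfolding ideal_def quotient_ideal_def subspace_def by blast
  show "I \<subseteq> {x. x +o I \<in> Q}" using I_eq \<open>I \<in> Q\<close> by auto
  show "Q = factor {x. x +o I \<in> Q} I" using Q by (auto simp: quotient_ideal_def factor_def)
qed

lemma quotient_ideal_factor: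
  assumes "ideal I" "ideal J" "I \<subseteq> J"
  shows "quotient_ideal I (factor J I)"
proof -
  note iff = coset_in_factor_iff[OF idealD(1)[OF assms(1)] idealD(1)[OF assms(2)] assms(3)]
  have "0 +o I = I" using coset_eq_self_iff idealD(1)[OF assms(1)] subspace_0 by blast
  moreover have "0 +o I \<in> factor J I" using idealD(1)[OF assms(2)] subspace_0 iff by blast
  ultimately have "I \<in> factor J I" by simp
  then show ?thesis unfolding quotient_ideal_def iff
    using idealD[OF assms(2)] subspace_add subspace_scale by (auto simp: factor_def)
qed

lemma factor_eq_iff:
  assumes "ideal I" "ideal J" "ideal K" "I \<subseteq> J" "I \<subseteq> K"
  shows "factor J I = factor K I \<longleftrightarrow> J = K"
  using coset_in_factor_iff[OF idealD(1)[OF assms(1)] idealD(1)[OF assms(2)] assms(4)]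
    coset_in_factor_iff[OF idealD(1)[OF assms(1)] idealD(1)[OF assms(3)] assms(5)] by blast

lemma factor_self: "ideal I \<Longrightarrow> factor I I = {I}"
  using coset_eq_self_iff[OF idealD(1)] subspace_0[OF idealD(1)] by (auto simp: factor_def)

text \<open>By the correspondence theorem, minimality in the quotient can be tested on ideals of
  \<open>A\<close> itself; all later arguments use this form.\<close>

lemma chief_factor_iff:
  assumes I: "ideal I" and J: "ideal J" and "I \<subseteq> J"
  shows "chief_factor J I \<longleftrightarrow> J \<noteq> I \<and> (\<forall>K. ideal K \<and> I \<subseteq> K \<and> K \<subseteq> J \<and> K \<noteq> I \<longrightarrow> K = J)"
proof
  assume ch: "chief_factor J I"
  have "K = J" if "ideal K" "I \<subseteq> K" "K \<subseteq> J" "K \<noteq> I" for K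
  proof -
    have "quotient_ideal I (factor K I)" using quotient_ideal_factor that I by blast
    moreover have "factor K I \<noteq> {I}"
      using factor_eq_iff[OF I that(1) I that(2)] factor_self[OF I] that(4) by auto
    moreover have "factor K I \<subseteq> factor J I" using that by (auto simp: factor_def)
    ultimately have "factor K I = factor J I" using ch by (simp add: chief_factor_def)
    then show "K = J" using factor_eq_iff that assms by blast
  qed
  moreover have "J \<noteq> I" using ch factor_self[OF I] by (auto simp: chief_factor_def)
  ultimately show "J \<noteq> I \<and> (\<forall>K. ideal K \<and> I \<subseteq> K \<and> K \<subseteq> J \<and> K \<noteq> I \<longrightarrow> K = J)" by blast
next
  assume min: "J \<noteq> I \<and> (\<forall>K. ideal K \<and> I \<subseteq> K \<and> K \<subseteq> J \<and> K \<noteq> I \<longrightarrow> K = J)"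
  have "Q = factor J I" if "quotient_ideal I Q" "Q \<noteq> {I}" "Q \<subseteq> factor J I" for Q
  proof -
    define K where "K = {x. x +o I \<in> Q}"
    have K: "ideal K" "I \<subseteq> K" "Q = factor K I"
      using quotient_idealD[OF that(1) I] by (auto simp: K_def)
    have "K \<subseteq> J"
      using that(3) coset_in_factor_iff[OF idealD(1)[OF I] idealD(1)[OF J] \<open>I \<subseteq> J\<close>]
      by (auto simp: K_def)
    moreover have "K \<noteq> I" using K(3) that(2) factor_self[OF I] by auto
    ultimately show ?thesis using K min by blast
  qed
  moreover have "factor J I \<noteq> {I}"
    using factor_eq_iff[OF I J I] factor_self[OF I] min \<open>I \<subseteq> J\<close> by auto
  ultimately show "chief_factor J I"
    using quotient_ideal_factor[OF assms] by (auto simp: chief_factor_def)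
qed

lemma central_factor_iff:
  assumes "subspace I"
  shows "central_factor J I \<longleftrightarrow> (\<forall>x\<in>J. \<forall>y. x \<cdot> y \<in> I \<and> y \<cdot> x \<in> I)"
  using coset_eq_self_iff[OF assms] by (simp add: central_factor_def)

text \<open>With \<open>b\<close> replaced by \<open>c b\<close>, the last condition says \<open>x + c x b, x + c b x \<in> Q\<close> for every
  scalar \<open>c\<close>; in particular \<open>x b = x\<close> forces \<open>- x \<in> Q\<close>, so strictness comes for free in pointed
  cones.\<close>

definition algebra_cone :: "'a set \<Rightarrow> bool" where
  "algebra_cone Q \<longleftrightarrow> 0 \<in> Q \<and> (\<forall>x\<in>Q. \<forall>y\<in>Q. x + y \<in> Q) \<and> (\<forall>c\<ge>0. \<forall>x\<in>Q. c *s x \<in> Q)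
     \<and> (\<forall>x\<in>Q. \<forall>b. x + x \<cdot> b \<in> Q \<and> x + b \<cdot> x \<in> Q)"

definition pointed :: "'a set \<Rightarrow> bool" where
  "pointed Q \<longleftrightarrow> (\<forall>x\<in>Q. - x \<in> Q \<longrightarrow> x = 0)"

definition positives :: "'a rel \<Rightarrow> 'a set" where
  "positives r = {x. (0, x) \<in> r}"

lemma algebra_coneD:
  assumes "algebra_cone Q"
  shows "0 \<in> Q" "x \<in> Q \<Longrightarrow> y \<in> Q \<Longrightarrow> x + y \<in> Q" "0 \<le> c \<Longrightarrow> x \<in> Q \<Longrightarrow> c *s x \<in> Q"
    "x \<in> Q \<Longrightarrow> x + x \<cdot> b \<in> Q" "x \<in> Q \<Longrightarrow> x + b \<cdot> x \<in> Q"
    "x \<in> Q \<Longrightarrow> x - x \<cdot> b \<in> Q" "x \<in> Q \<Longrightarrow> x - b \<cdot> x \<in> Q"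
  using assms unfolding algebra_cone_def
  by (blast, blast, blast, blast, blast, metis mult_simps(6) diff_conv_add_uminus,
      metis mult_simps(5) diff_conv_add_uminus)

lemma po_algebra_le_iff:
  assumes "po_algebra r"
  shows "(x, y) \<in> r \<longleftrightarrow> y - x \<in> positives r"
proof -
  have *: "(x + z, y + z) \<in> r" if "(x, y) \<in> r" for x y z
    using assms that by (auto simp: po_algebra_def)
  show ?thesis using *[of x y "- x"] *[of 0 "y - x" x] by (auto simp: positives_def)
qed

lemma po_algebra_positives:
  assumes r: "po_algebra r"
  shows "algebra_cone (positives r)" "pointed (positives r)"
proof -
  note le = po_algebra_le_iff[OF r]
  have po: "refl r" "trans r" "antisym r"
    using r by (auto simp: po_algebra_def partial_order_on_def preorder_on_def)
  have 0: "0 \<in> positives r" using po(1) by (auto simp: positives_def refl_on_def)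
  have add: "x + y \<in> positives r" if "x \<in> positives r" "y \<in> positives r" for x y
  proof -
    have "(0, x) \<in> r" "(x, x + y) \<in> r" using that le by auto
    then show ?thesis using po(2) by (auto simp: positives_def dest: transD)
  qed
  have mult: "x + x \<cdot> b \<in> positives r \<and> x + b \<cdot> x \<in> positives r" if "x \<in> positives r" for x b
  proof (cases "x = 0")
    case True
    then show ?thesis using 0 by (simp add: mult_simps)
  next
    case False
    then have "(0, x) \<in> r - Id" using that by (auto simp: positives_def)
    \<comment> \<open>The order axiom is applied to \<open>- b\<close>, which yields the plus sign
      required of a cone.\<close>
    then have "(x \<cdot> (- b), x) \<in> r" "((- b) \<cdot> x, x) \<in> r" using r by (auto simp: po_algebra_def)
    then show ?thesis by (simp add: le mult_simps)
  qed
  have "c *s x \<in> positives r" if "0 \<le> c" "x \<in> positives r" for c x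
    using r that by (force simp: po_algebra_def positives_def)
  then show "algebra_cone (positives r)" using 0 add mult by (simp add: algebra_cone_def)
  have "x = 0" if "x \<in> positives r" "- x \<in> positives r" for x
  proof -
    have "(0, x) \<in> r" "(x, 0) \<in> r" using that le[of x 0] by (auto simp: positives_def)
    then show ?thesis using po(3) by (auto dest: antisymD)
  qed
  then show "pointed (positives r)" by (auto simp: pointed_def)
qed

lemma po_algebra_of_cone:
  assumes Q: "algebra_cone Q" "pointed Q"
  shows "po_algebra {(x, y). y - x \<in> Q}"
  unfolding po_algebra_def
proof (intro conjI allI impI)
  note Q1 = algebra_coneD[OF Q(1)]
  show "partial_order_on UNIV {(x, y). y - x \<in> Q}"
    unfolding partial_order_on_def preorder_on_def
  proof (intro conjI)
    show "refl {(x, y). y - x \<in> Q}" using Q1(1) by (auto simp: refl_on_def)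
    show "trans {(x, y). y - x \<in> Q}"
    proof (rule transI)
      fix x y z assume "(x, y) \<in> {(x, y). y - x \<in> Q}" "(y, z) \<in> {(x, y). y - x \<in> Q}"
      then show "(x, z) \<in> {(x, y). y - x \<in> Q}" using Q1(2)[of "y - x" "z - y"] by simp
    qed
    show "antisym {(x, y). y - x \<in> Q}"
    proof (rule antisymI)
      fix x y assume "(x, y) \<in> {(x, y). y - x \<in> Q}" "(y, x) \<in> {(x, y). y - x \<in> Q}"
      then have "y - x \<in> Q" "- (y - x) \<in> Q" by auto
      then have "y - x = 0" using Q(2) unfolding pointed_def by blast
      then show "x = y" by simp
    qed
  qed auto
  fix x y z and c
  show "(x + z, y + z) \<in> {(x, y). y - x \<in> Q}" if "(x, y) \<in> {(x, y). y - x \<in> Q}" using that by simp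
  show "(c *s x, c *s y) \<in> {(x, y). y - x \<in> Q}" if "0 \<le> c \<and> (x, y) \<in> {(x, y). y - x \<in> Q}"
    using that Q1(3)[of c "y - x"] by (simp add: scale_right_diff_distrib)
next
  note Q1 = algebra_coneD[OF Q(1)]
  fix a b assume "(0, a) \<in> {(x, y). y - x \<in> Q} - Id"
  then have a: "a \<in> Q" "a \<noteq> 0" by auto
  then have na: "- a \<notin> Q" using Q(2) unfolding pointed_def by blast
  \<comment> \<open>If \<open>a b = a\<close>, then \<open>a - a (2 b) = - a\<close> would lie in
    \<open>Q\<close>.\<close>
  have "a \<cdot> b \<noteq> a" using Q1(6)[OF a(1), of "2 *s b"] na by (auto simp: mult_simps scale_2)
  then show "(a \<cdot> b, a) \<in> {(x, y). y - x \<in> Q} - Id" using Q1(6)[OF a(1)] by auto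
  have "b \<cdot> a \<noteq> a" using Q1(7)[OF a(1), of "2 *s b"] na by (auto simp: mult_simps scale_2)
  then show "(b \<cdot> a, a) \<in> {(x, y). y - x \<in> Q} - Id" using Q1(7)[OF a(1)] by auto
qed

text \<open>Zorn's lemma: the union of a chain of orders is the order given by the union of their
  positive cones.\<close>

lemma ex_maximal_order: "\<exists>r. maximal_order r"
proof -
  have "\<exists>M\<in>Collect po_algebra. \<forall>X\<in>Collect po_algebra. M \<subseteq> X \<longrightarrow> X = M"
  proof (rule subset_Zorn_nonempty)
    show "Collect po_algebra \<noteq> {}"
      using po_algebra_of_cone[of "{0}"] by (auto simp: algebra_cone_def pointed_def mult_simps)
  next
    fix C assume "C \<noteq> {}" and ch: "subset.chain (Collect po_algebra) C"
    have po: "po_algebra r" if "r \<in> C" for r using ch that by (auto simp: subset.chain_def)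
    define Q where "Q = (\<Union>r\<in>C. positives r)"
    \<comment> \<open>Any two elements of \<open>Q\<close> are positive for one common order of the
      chain, so conditions on two elements pass to the union.\<close>
    have two: "\<exists>r\<in>C. x \<in> positives r \<and> y \<in> positives r" if xy: "x \<in> Q" "y \<in> Q" for x y
    proof -
      obtain r r' where rr: "r \<in> C" "x \<in> positives r" "r' \<in> C" "y \<in> positives r'"
        using xy by (auto simp: Q_def)
      then have "r \<subseteq> r' \<or> r' \<subseteq> r" using ch by (auto simp: subset.chain_def)
      then show ?thesis using rr by (auto simp: positives_def)
    qed
    note D = algebra_coneD[OF po_algebra_positives(1)[OF po]]
    have "algebra_cone Q"
      unfolding algebra_cone_def
    proof (intro conjI ballI allI impI)
      show "0 \<in> Q" using \<open>C \<noteq> {}\<close> D(1) by (auto simp: Q_def)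
      show "x + y \<in> Q" if "x \<in> Q" "y \<in> Q" for x y
        using two[OF that] D(2) by (auto simp: Q_def)
      show "c *s x \<in> Q" if cx: "0 \<le> c" "x \<in> Q" for c x
      proof -
        obtain r where "r \<in> C" "x \<in> positives r" using cx by (auto simp: Q_def)
        then show ?thesis using D(3)[of r c x] cx unfolding Q_def by blast
      qed
      show "x + x \<cdot> b \<in> Q" "x + b \<cdot> x \<in> Q" if x: "x \<in> Q" for x b
      proof -
        obtain r where "r \<in> C" "x \<in> positives r" using x by (auto simp: Q_def)
        then show "x + x \<cdot> b \<in> Q" "x + b \<cdot> x \<in> Q"
          using D(4,5)[of r x b] unfolding Q_def by blast+
      qed
    qed
    moreover have "pointed Q"
      using two po_algebra_positives(2)[OF po] unfolding pointed_def by blast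
    moreover have "(\<Union>C) = {(x, y). y - x \<in> Q}"
      using po_algebra_le_iff[OF po] by (auto simp: Q_def)
    ultimately show "\<Union>C \<in> Collect po_algebra" using po_algebra_of_cone by simp
  qed
  then show ?thesis unfolding maximal_order_def by blast
qed

text \<open>Adding to \<open>positives r\<close> the elements of \<open>Q\<close> outside its lineality space gives again a pointed
  algebra cone.\<close>

lemma maximal_order_extension:
  assumes r: "maximal_order r" and Q: "algebra_cone Q" and sub: "positives r \<subseteq> Q"
    and x: "x \<in> Q" "- x \<notin> Q"
  shows "x \<in> positives r"
proof -
  have po: "po_algebra r" using r by (simp add: maximal_order_def)
  note P = po_algebra_positives[OF po]
  note P1 = algebra_coneD[OF P(1)] and Q1 = algebra_coneD[OF Q]
  define N where "N = {y \<in> Q. - y \<notin> Q}"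
  define R where "R = positives r \<union> N"
  have RQ: "R \<subseteq> Q" using sub by (auto simp: R_def N_def)
  \<comment> \<open>A negative of \<open>y + z\<close> in \<open>Q\<close> would, after adding
    \<open>z\<close>, put \<open>- y\<close> into \<open>Q\<close>.\<close>
  have N_add: "y + z \<in> N" if "y \<in> N" "z \<in> Q" for y z
  proof -
    have "- (y + z) \<notin> Q"
    proof
      assume "- (y + z) \<in> Q"
      from Q1(2)[OF this \<open>z \<in> Q\<close>] show False using that by (simp add: N_def)
    qed
    then show ?thesis using that Q1(2) by (auto simp: N_def)
  qed
  have N_mult: "y + y \<cdot> b \<in> N \<and> y + b \<cdot> y \<in> N" if "y \<in> N" for y b
  proof -
    have y: "y \<in> Q" "- y \<notin> Q" using that by (auto simp: N_def)
    \<comment> \<open>This is applied to \<open>w = y + y b\<close>, for which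
      \<open>w + w - y = y + y (2 b)\<close> is in \<open>Q\<close>, and likewise to
      \<open>y + b y\<close>.\<close>
    have "w \<in> N" if w: "w \<in> Q" "w + w - y \<in> Q" for w
    proof -
      have "- w \<notin> Q"
      proof
        assume "- w \<in> Q"
        from Q1(2)[OF w(2) Q1(2)[OF this this]] show False using y by simp
      qed
      then show ?thesis using w by (simp add: N_def)
    qed
    from this[of "y + y \<cdot> b"] this[of "y + b \<cdot> y"] show ?thesis
      using Q1(4)[OF y(1), of b] Q1(5)[OF y(1), of b]
        Q1(4)[OF y(1), of "2 *s b"] Q1(5)[OF y(1), of "2 *s b"]
      by (simp add: mult_simps scale_right_distrib scale_2 algebra_simps)
  qed
  have N_scale: "c *s y \<in> R" if "y \<in> N" "0 \<le> c" for c y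
  proof (cases "c = 0")
    case True
    then show ?thesis using P1(1) by (simp add: R_def)
  next
    case False
    have "- y \<in> Q" if "- (c *s y) \<in> Q"
      using Q1(3)[OF _ that, of "inverse c"] \<open>0 \<le> c\<close> False by simp
    then have "c *s y \<in> N" using that Q1(3)[of c y] by (auto simp: N_def)
    then show ?thesis by (simp add: R_def)
  qed
  have "algebra_cone R"
    unfolding algebra_cone_def
  proof (intro conjI ballI allI impI)
    show "0 \<in> R" using P1(1) by (simp add: R_def)
    fix y assume y: "y \<in> R"
    show "y + z \<in> R" if "z \<in> R" for z
    proof (cases "y \<in> N \<or> z \<in> N")
      case True
      then show ?thesis using N_add[of y z] N_add[of z y] y that RQ by (auto simp: R_def add.commute)
    next
      case False
      then show ?thesis using y that P1(2) by (auto simp: R_def)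
    qed
    show "y + y \<cdot> b \<in> R" "y + b \<cdot> y \<in> R" for b using y N_mult P1(4,5) by (auto simp: R_def)
  next
    fix c :: 'f and y assume "0 \<le> c" "y \<in> R"
    then show "c *s y \<in> R" using N_scale P1(3) by (auto simp: R_def)
  qed
  moreover have "pointed R"
    unfolding pointed_def
  proof (intro ballI impI)
    fix y assume y: "y \<in> R" "- y \<in> R"
    then have "y \<in> Q" "- y \<in> Q" using RQ by auto
    \<comment> \<open>As both \<open>y\<close> and \<open>- y\<close> lie in \<open>Q\<close>,
      neither of them belongs to \<open>N\<close>.\<close>
    then have "y \<in> positives r" "- y \<in> positives r" using y by (auto simp: R_def N_def)
    then show "y = 0" using P(2) by (auto simp: pointed_def)
  qed
  ultimately have "po_algebra {(x, y). y - x \<in> R}" by (rule po_algebra_of_cone)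
  moreover have "r \<subseteq> {(x, y). y - x \<in> R}" using po_algebra_le_iff[OF po] by (auto simp: R_def)
  ultimately have "{(x, y). y - x \<in> R} = r" using r by (auto simp: maximal_order_def)
  moreover have "(0, x) \<in> {(x, y). y - x \<in> R}" using x by (simp add: R_def N_def)
  ultimately show ?thesis by (auto simp: positives_def)
qed

end

section \<open>Convex ideals of a maximal order and existence of adapted series\<close>

context fin_dim_algebra
begin

text \<open>An element between 0 and an element of \<open>I\<close> is one of two positive summands
  of the latter, which turns convexity into a property of the cone.\<close>

lemma convex_ideal_iff:
  assumes "po_algebra r"
  shows "convex_ideal r I \<longleftrightarrow> ideal I \<and> (\<forall>a b. a + b \<in> I \<and> a \<in> positives r \<and> b \<in> positives r \<longrightarrow> a \<in> I)"
proof -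
  have "(\<forall>a\<in>I. \<forall>b. (0, b) \<in> r \<and> (b, a) \<in> r \<longrightarrow> b \<in> I)
      \<longleftrightarrow> (\<forall>a b. a + b \<in> I \<and> a \<in> positives r \<and> b \<in> positives r \<longrightarrow> a \<in> I)"
    unfolding po_algebra_le_iff[OF assms] diff_0_right
    by (metis add.commute add_diff_cancel_left' diff_add_cancel)
  then show ?thesis by (simp add: convex_ideal_def)
qed

lemma quotient_order_iff:
  assumes r: "po_algebra r" and I: "subspace I"
  shows "(x +o I, y +o I) \<in> quotient_order r I \<longleftrightarrow> (\<exists>i\<in>I. y - x + i \<in> positives r)"
proof
  assume "(x +o I, y +o I) \<in> quotient_order r I"
  then obtain x' y' a b where *: "x +o I = x' +o I" "y +o I = y' +o I"
    "a \<in> x' +o I" "b \<in> y' +o I" "(a, b) \<in> r"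
    unfolding quotient_order_def by blast
  from *(3,4) obtain i j where ij: "i \<in> I" "j \<in> I" "a = x' + i" "b = y' + j"
    by (auto simp: elt_set_plus_def)
  have m: "x - x' \<in> I" "y - y' \<in> I" using *(1,2) by (simp_all add: coset_eq_iff[OF I])
  have "(x - x') - (y - y') + (j - i) \<in> I" 
    by (rule subspace_add[OF I subspace_diff[OF I m] subspace_diff[OF I ij(2,1)]])
  moreover have "y - x + ((x - x') - (y - y') + (j - i)) = b - a" using ij by simp
  ultimately show "\<exists>i\<in>I. y - x + i \<in> positives r"
    using *(5) unfolding po_algebra_le_iff[OF r] by (intro bexI) auto
next
  assume "\<exists>i\<in>I. y - x + i \<in> positives r"
  then obtain i where i: "i \<in> I" "y - x + i \<in> positives r" by blast
  have "(x, y + i) \<in> r" using i(2) by (simp add: po_algebra_le_iff[OF r] algebra_simps)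
  moreover have "x \<in> x +o I" "y + i \<in> y +o I"
    using subspace_0[OF I] i(1) by (force simp: elt_set_plus_def)+
  ultimately show "(x +o I, y +o I) \<in> quotient_order r I" unfolding quotient_order_def by blast
qed

text \<open>This supplies the enlarged cones to which the maximality of the order is
  applied.\<close>

lemma algebra_cone_sum:
  assumes "algebra_cone Q" "algebra_cone R"
  shows "algebra_cone {q + w | q w. q \<in> Q \<and> w \<in> R}"
  unfolding algebra_cone_def
proof (intro conjI ballI allI impI)
  note Q = algebra_coneD[OF assms(1)] and R = algebra_coneD[OF assms(2)]
  show "0 \<in> {q + w | q w. q \<in> Q \<and> w \<in> R}" using Q(1) R(1) by force
  fix x assume "x \<in> {q + w | q w. q \<in> Q \<and> w \<in> R}"
  then obtain q w where x: "x = q + w" "q \<in> Q" "w \<in> R" by blast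
  show "x + y \<in> {q + w | q w. q \<in> Q \<and> w \<in> R}" if y: "y \<in> {q + w | q w. q \<in> Q \<and> w \<in> R}" for y
  proof -
    obtain q' w' where "y = q' + w'" "q' \<in> Q" "w' \<in> R" using y by blast
    then have "x + y = (q + q') + (w + w')" "q + q' \<in> Q" "w + w' \<in> R" using x Q(2) R(2) by auto
    then show ?thesis by blast
  qed
  have "x + x \<cdot> b = (q + q \<cdot> b) + (w + w \<cdot> b)" "x + b \<cdot> x = (q + b \<cdot> q) + (w + b \<cdot> w)" for b
    using x by (simp_all add: mult_simps)
  then show "x + x \<cdot> b \<in> {q + w | q w. q \<in> Q \<and> w \<in> R}"
    "x + b \<cdot> x \<in> {q + w | q w. q \<in> Q \<and> w \<in> R}" for b
    using Q(4,5)[OF x(2), of b] R(4,5)[OF x(3), of b] by blast+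
next
  note Q = algebra_coneD[OF assms(1)] and R = algebra_coneD[OF assms(2)]
  fix c :: 'f and x assume c: "0 \<le> c" and "x \<in> {q + w | q w. q \<in> Q \<and> w \<in> R}"
  then obtain q w where "x = q + w" "q \<in> Q" "w \<in> R" by blast
  then have "c *s x = c *s q + c *s w" "c *s q \<in> Q" "c *s w \<in> R"
    using c Q(3) R(3) by (auto simp: scale_right_distrib)
  then show "c *s x \<in> {q + w | q w. q \<in> Q \<and> w \<in> R}" by blast
qed

lemma algebra_cone_ideal: "ideal I \<Longrightarrow> algebra_cone I"
  by (auto simp: algebra_cone_def ideal_def subspace_def)

context
  fixes r
  assumes r: "maximal_order r"
begin

lemma maximal_order_po_algebra: "po_algebra r"
  using r by (simp add: maximal_order_def)

lemmas positive_cone = algebra_coneD[OF po_algebra_positives(1)[OF maximal_order_po_algebra]]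

lemma positives_pointed: "x \<in> positives r \<Longrightarrow> - x \<in> positives r \<Longrightarrow> x = 0"
  using po_algebra_positives(2)[OF maximal_order_po_algebra] by (auto simp: pointed_def)

lemma convex_idealD:
  assumes "convex_ideal r I"
  shows "ideal I" "subspace I"
    "a + b \<in> I \<Longrightarrow> a \<in> positives r \<Longrightarrow> b \<in> positives r \<Longrightarrow> a \<in> I"
  using assms unfolding convex_ideal_iff[OF maximal_order_po_algebra] ideal_def by blast+

text \<open>If \<open>- (p + i)\<close> were also in the cone \<open>P + I\<close>, then
  \<open>p + q\<close> would be in \<open>I\<close> for some positive \<open>q\<close>, and
  convexity would force \<open>p\<close> into \<open>I\<close>. Outside \<open>I\<close>, positivity
  thus depends only on the coset, which is the source of the lexicographic property.\<close>

lemma positive_add_convex_ideal: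
  assumes I: "convex_ideal r I" and p: "p \<in> positives r" "p \<notin> I" and i: "i \<in> I"
  shows "p + i \<in> positives r"
proof (rule maximal_order_extension[OF r])
  let ?Q = "{q + w | q w. q \<in> positives r \<and> w \<in> I}"
  show "algebra_cone ?Q"
    by (intro algebra_cone_sum algebra_cone_ideal po_algebra_positives(1)[OF maximal_order_po_algebra] convex_idealD(1)[OF I])
  show "positives r \<subseteq> ?Q" using subspace_0[OF convex_idealD(2)[OF I]] by force
  show "p + i \<in> ?Q" using p i by blast
  show "- (p + i) \<notin> ?Q"
  proof
    assume "- (p + i) \<in> ?Q"
    then obtain q w where qw: "- (p + i) = q + w" "q \<in> positives r" "w \<in> I" by blast
    have "p + q = - (i + w)" using qw(1) by (simp add: algebra_simps eq_neg_iff_add_eq_0)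
    also have "\<dots> \<in> I" using i qw(3) convex_idealD(2)[OF I] by (intro subspace_neg subspace_add)
    finally show False using convex_idealD(3)[OF I] p qw(2) by blast
  qed
qed

text \<open>As \<open>z\<close> is central modulo \<open>I\<close>, its nonnegative multiples
  together with \<open>I\<close> form a cone \<open>?W\<close>, although \<open>z\<close> itself
  need not generate one.\<close>

lemma central_comparable:
  assumes I: "convex_ideal r I" and z: "z \<notin> I" "\<And>b. z \<cdot> b \<in> I \<and> b \<cdot> z \<in> I"
  shows "z \<in> positives r \<or> - z \<in> positives r"
proof (cases "z \<in> positives r")
  case nz: False
  note sub = convex_idealD(2)[OF I]
  let ?W = "{c *s z + i | c i. 0 \<le> c \<and> i \<in> I}"
  let ?Q = "{q + w | q w. q \<in> positives r \<and> w \<in> ?W}"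
  have W: "algebra_cone ?W"
    unfolding algebra_cone_def
  proof (intro conjI ballI allI impI)
    show "0 \<in> ?W" using subspace_0[OF sub] by (intro CollectI exI[of _ 0]) simp
    fix x assume "x \<in> ?W"
    then obtain c i where x: "x = c *s z + i" "0 \<le> c" "i \<in> I" by blast
    show "x + y \<in> ?W" if y: "y \<in> ?W" for y
    proof -
      obtain d j where "y = d *s z + j" "0 \<le> d" "j \<in> I" using y by blast
      then have "x + y = (c + d) *s z + (i + j)" "0 \<le> c + d" "i + j \<in> I"
        using x subspace_add[OF sub] by (auto simp: scale_left_distrib)
      then show ?thesis by blast
    qed
    have "x + x \<cdot> b = c *s z + (i + (c *s (z \<cdot> b) + i \<cdot> b))"
      "x + b \<cdot> x = c *s z + (i + (c *s (b \<cdot> z) + b \<cdot> i))" for b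
      using x by (simp_all add: mult_simps)
    moreover have "i + (c *s (z \<cdot> b) + i \<cdot> b) \<in> I" "i + (c *s (b \<cdot> z) + b \<cdot> i) \<in> I" for b
      using z(2) x(3) idealD(2,3)[OF convex_idealD(1)[OF I]] sub
      by (auto intro!: subspace_add subspace_scale)
    ultimately show "x + x \<cdot> b \<in> ?W" "x + b \<cdot> x \<in> ?W" for b using x(2) by blast+
  next
    fix c :: 'f and x assume c: "0 \<le> c" and "x \<in> ?W"
    then obtain d i where "x = d *s z + i" "0 \<le> d" "i \<in> I" by blast
    then have "c *s x = (c * d) *s z + c *s i" "0 \<le> c * d" "c *s i \<in> I"
      using c subspace_scale[OF sub] by (auto simp: scale_right_distrib)
    then show "c *s x \<in> ?W" by blast
  qed
  have "0 *s z + 0 \<in> ?W" "1 *s z + 0 \<in> ?W" using subspace_0[OF sub] zero_le_one by blast+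
  then have mem: "0 \<in> ?W" "z \<in> ?W" by simp_all
  have "positives r \<subseteq> ?Q" using mem(1) by force
  moreover have "0 + z \<in> ?Q" using mem(2) positive_cone(1) by blast
  then have "z \<in> ?Q" by (simp only: add_0)
  \<comment> \<open>Otherwise \<open>maximal_order_extension\<close> would make \<open>z\<close>
    positive.\<close>
  ultimately have "- z \<in> ?Q"
    using nz maximal_order_extension[OF r algebra_cone_sum[OF po_algebra_positives(1)[OF maximal_order_po_algebra] W]] by blast
  then obtain p c i where pci: "- z = p + (c *s z + i)" "p \<in> positives r" "0 \<le> c" "i \<in> I" by blast
  \<comment> \<open>Collecting the multiples of \<open>z\<close> exhibits \<open>- z\<close> as a
    positive multiple of \<open>p + i\<close>.\<close>
  have "p + i = (p + (c *s z + i)) - c *s z" by simp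
  also have "\<dots> = (1 + c) *s (- z)" unfolding pci(1)[symmetric] by (simp add: scale_left_distrib)
  finally have eq: "p + i = (1 + c) *s (- z)" .
  have c1: "1 + c \<noteq> 0" "0 \<le> inverse (1 + c)" using pci(3) by (auto simp: add_nonneg_eq_0_iff)
  have nz': "- z = inverse (1 + c) *s (p + i)" using c1(1) by (simp add: eq del: scale_minus_right)
  have "p \<notin> I"
  proof
    assume "p \<in> I"
    then have "- z \<in> I" unfolding nz' using pci(4) sub by (intro subspace_scale subspace_add)
    then show False using z(1) subspace_neg[OF sub, of "- z"] by simp
  qed
  then have "p + i \<in> positives r" using positive_add_convex_ideal[OF I] pci by blast
  then have "- z \<in> positives r" unfolding nz' using positive_cone(3) c1(2) by blast
  then show ?thesis ..
qed simp

text \<open>Since \<open>c\<close> takes both signs, every scalar multiple of \<open>x\<close> lies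
  between \<open>- a\<close> and \<open>a\<close>.\<close>

definition infinitesimals :: "'a \<Rightarrow> 'a set" where
  "infinitesimals a = {x. \<forall>c. a + c *s x \<in> positives r}"

lemma convex_ideal_infinitesimals:
  assumes a: "a \<in> positives r"
  shows "convex_ideal r (infinitesimals a)"
proof -
  have half: "w \<in> positives r" if "k *s w \<in> positives r" "0 < k" for k w
    using positive_cone(3)[OF _ that(1), of "inverse k"] that(2) by simp
  have sub: "subspace (infinitesimals a)"
    unfolding subspace_def
  proof (intro conjI ballI allI)
    show "0 \<in> infinitesimals a" using a by (simp add: infinitesimals_def)
    fix x assume x: "x \<in> infinitesimals a"
    show "c *s x \<in> infinitesimals a" for c using x by (simp add: infinitesimals_def)
    fix y assume y: "y \<in> infinitesimals a"
    have "a + c *s (x + y) \<in> positives r" for c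
    proof -
      \<comment> \<open>The two bounds with scalar \<open>2 c\<close> add up to twice the wanted
        element.\<close>
      have "(a + (2 * c) *s x) + (a + (2 * c) *s y) \<in> positives r"
        using x y positive_cone(2) by (simp add: infinitesimals_def)
      moreover have "(a + (2 * c) *s x) + (a + (2 * c) *s y) = 2 *s (a + c *s (x + y))"
        by (simp add: scale_right_distrib scale_2[of a] algebra_simps)
      ultimately show ?thesis using half[of 2] by simp
    qed
    then show "x + y \<in> infinitesimals a" by (simp add: infinitesimals_def)
  qed
  have "ideal (infinitesimals a)"
    unfolding ideal_def
  proof (intro conjI ballI allI sub)
    fix x y assume x: "x \<in> infinitesimals a"
    have m: "a + c *s x \<in> positives r" for c using x by (simp add: infinitesimals_def)
    have "a + c *s (x \<cdot> y) \<in> positives r \<and> a + c *s (y \<cdot> x) \<in> positives r" for c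
    proof -
      \<comment> \<open>With \<open>w = x y\<close> and \<open>v = a y\<close> the right-hand side
        is a sum of three positive terms: \<open>q + q y\<close> for \<open>q = a + 3 c x\<close>,
        then \<open>a - a y\<close>, then \<open>a - 3 c x\<close>. For \<open>w = y x\<close> take
        \<open>v = y a\<close>.\<close>
      have "3 *s (a + c *s w) = ((a + (3 * c) *s x) + (v + (3 * c) *s w)) + ((a - v) + (a + (- 3 * c) *s x))"
        for v w
        by (simp add: scale_right_distrib scale_left_distrib[of 1 2 a, simplified] scale_2 algebra_simps)
      moreover have "(a + (3 * c) *s x) + (a \<cdot> y + (3 * c) *s (x \<cdot> y)) \<in> positives r"
        "(a + (3 * c) *s x) + (y \<cdot> a + (3 * c) *s (y \<cdot> x)) \<in> positives r"
        using positive_cone(4,5)[OF m[of "3 * c"], of y] by (simp_all add: mult_simps)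
      moreover have "(a - a \<cdot> y) + (a + (- 3 * c) *s x) \<in> positives r"
        "(a - y \<cdot> a) + (a + (- 3 * c) *s x) \<in> positives r"
        using positive_cone(2) positive_cone(6,7)[OF a] m by blast+
      ultimately have "3 *s (a + c *s (x \<cdot> y)) \<in> positives r" "3 *s (a + c *s (y \<cdot> x)) \<in> positives r"
        using positive_cone(2) by metis+
      then show ?thesis using half[of 3] by simp
    qed
    then show "x \<cdot> y \<in> infinitesimals a" "y \<cdot> x \<in> infinitesimals a"
      by (auto simp: infinitesimals_def)
  qed
  moreover have "b \<in> infinitesimals a"
    if "b + d \<in> infinitesimals a" "b \<in> positives r" "d \<in> positives r" for b d
  proof -
    have "a + c *s b \<in> positives r" for c
    proof (cases "0 \<le> c")
      case True
      then show ?thesis using positive_cone(2)[OF a positive_cone(3)[OF _ that(2)]] by blast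
    next
      case False
      \<comment> \<open>For negative \<open>c\<close>, adding the positive element
        \<open>- c d\<close> cancels the contribution of \<open>d\<close>.\<close>
      have "a + c *s (b + d) \<in> positives r" using that(1) by (simp add: infinitesimals_def)
      moreover have "(- c) *s d \<in> positives r" using False that(3) positive_cone(3)[of "- c" d] by auto
      ultimately have "a + c *s (b + d) + (- c) *s d \<in> positives r" by (rule positive_cone(2))
      then show ?thesis by (simp add: scale_right_distrib)
    qed
    then show ?thesis by (simp add: infinitesimals_def)
  qed
  ultimately show ?thesis unfolding convex_ideal_iff[OF maximal_order_po_algebra] by blast
qed

lemma not_mem_infinitesimals:
  assumes "a \<in> positives r" "a \<noteq> 0"
  shows "a \<notin> infinitesimals a"
proof
  assume "a \<in> infinitesimals a"
  then have "a + (- 2) *s a \<in> positives r" unfolding infinitesimals_def by blast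
  then have "- a \<in> positives r" by (simp add: scale_2)
  then show False using positives_pointed assms by blast
qed

text \<open>The scalar is absorbed into the other factor:
  \<open>a + c (a b) = a + a (c b)\<close>.\<close>

lemma mult_mem_infinitesimals:
  assumes "a \<in> positives r"
  shows "a \<cdot> b \<in> infinitesimals a" "b \<cdot> a \<in> infinitesimals a"
  using positive_cone(4,5)[OF assms, of "_ *s b"] by (auto simp: infinitesimals_def mult_simps)

lemma convex_ideal_subset_infinitesimals:
  assumes "convex_ideal r I" "a \<in> positives r" "a \<notin> I"
  shows "I \<subseteq> infinitesimals a"
  using positive_add_convex_ideal[OF assms] subspace_scale[OF convex_idealD(2)[OF assms(1)]]
  by (auto simp: infinitesimals_def)

text \<open>Antisymmetry on cosets is convexity of \<open>I\<close>; totality is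
  \<open>central_comparable\<close> applied to a difference of representatives.\<close>

lemma linear_order_central_factor:
  assumes I: "convex_ideal r I" and J: "ideal J" "I \<subseteq> J" and central: "central_factor J I"
  shows "linear_order_on (factor J I) (factor_order r J I)"
proof -
  note sub = convex_idealD(2)[OF I]
  note iff = quotient_order_iff[OF maximal_order_po_algebra sub]
  note c = central[unfolded central_factor_iff[OF sub]]
  have refl: "(x +o I, x +o I) \<in> factor_order r J I" if "x \<in> J" for x
    using that iff positive_cone(1) subspace_0[OF sub] by (force simp: factor_order_def factor_def)
  have trans: "(x +o I, z +o I) \<in> factor_order r J I"
    if xyz: "x \<in> J" "y \<in> J" "z \<in> J" "(x +o I, y +o I) \<in> factor_order r J I"
      "(y +o I, z +o I) \<in> factor_order r J I" for x y z
  proof -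
    obtain i j where ij: "i \<in> I" "j \<in> I" "y - x + i \<in> positives r" "z - y + j \<in> positives r"
      using xyz(4,5) by (auto simp: factor_order_def iff)
    have "z - x + (i + j) \<in> positives r" using positive_cone(2)[OF ij(3,4)] by (simp add: algebra_simps)
    moreover have "i + j \<in> I" using ij subspace_add[OF sub] by blast
    ultimately show ?thesis using xyz(1,3) by (auto simp: factor_order_def iff factor_def)
  qed
  have antisym: "x +o I = y +o I"
    if xy: "(x +o I, y +o I) \<in> factor_order r J I" "(y +o I, x +o I) \<in> factor_order r J I" for x y
  proof -
    obtain i j where ij: "i \<in> I" "j \<in> I" "y - x + i \<in> positives r" "x - y + j \<in> positives r"
      using xy by (auto simp: factor_order_def iff)
    have "(y - x + i) + (x - y + j) \<in> I" using ij subspace_add[OF sub] by (simp add: algebra_simps)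
    then have "y - x + i \<in> I" using convex_idealD(3)[OF I] ij by blast
    then have "y - x \<in> I" using subspace_diff[OF sub _ ij(1)] by fastforce
    then show ?thesis using coset_eq_iff[OF sub] by metis
  qed
  have total: "(x +o I, y +o I) \<in> factor_order r J I \<or> (y +o I, x +o I) \<in> factor_order r J I"
    if xy: "x \<in> J" "y \<in> J" "x +o I \<noteq> y +o I" for x y
  proof -
    have "x - y \<notin> I" using xy(3) coset_eq_iff[OF sub] by blast
    moreover have "x - y \<in> J" using xy J(1) by (auto intro: subspace_diff idealD(1))
    ultimately have "x - y + 0 \<in> positives r \<or> y - x + 0 \<in> positives r"
      using central_comparable[OF I, of "x - y"] c by simp
    then have "(x +o I, y +o I) \<in> quotient_order r I \<or> (y +o I, x +o I) \<in> quotient_order r I"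
      unfolding iff using subspace_0[OF sub] by blast
    then show ?thesis using xy(1,2) by (auto simp: factor_order_def factor_def)
  qed
  show ?thesis
    unfolding linear_order_on_def partial_order_on_def preorder_on_def
  proof (intro conjI)
    show "refl_on (factor J I) (factor_order r J I)"
      using refl by (auto simp: refl_on_def factor_def)
    show "trans (factor_order r J I)"
    proof (rule transI)
      fix X Y Z assume *: "(X, Y) \<in> factor_order r J I" "(Y, Z) \<in> factor_order r J I"
      then obtain x y z where "x \<in> J" "y \<in> J" "z \<in> J" "X = x +o I" "Y = y +o I" "Z = z +o I"
        by (auto simp: factor_order_def factor_def)
      then show "(X, Z) \<in> factor_order r J I" using trans * by blast
    qed
    show "antisym (factor_order r J I)"
    proof (rule antisymI)
      fix X Y assume *: "(X, Y) \<in> factor_order r J I" "(Y, X) \<in> factor_order r J I"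
      then obtain x y where "X = x +o I" "Y = y +o I"
        by (auto simp: factor_order_def factor_def)
      then show "X = Y" using antisym * by blast
    qed
    show "total_on (factor J I) (factor_order r J I)"
      using total by (auto simp: total_on_def factor_def)
  qed (auto simp: factor_order_def)
qed

definition adapted_factor :: "'a set \<Rightarrow> 'a set \<Rightarrow> bool" where
  "adapted_factor J I \<longleftrightarrow>
     central_factor J I \<and> linear_order_on (factor J I) (factor_order r J I)
     \<or> \<not> central_factor J I \<and> chief_factor J I \<and> factor_order r J I = Id_on (factor J I)"

lemma ex_adapted_factor:
  assumes I: "convex_ideal r I" and "I \<noteq> UNIV"
  shows "\<exists>K. convex_ideal r K \<and> I \<subset> K \<and> adapted_factor K I"
proof -
  note sub = convex_idealD(2)[OF I]
  have "ideal UNIV" by (simp add: ideal_def)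
  then have "convex_ideal r UNIV" by (simp add: convex_ideal_def)
  then have "convex_ideal r UNIV \<and> I \<subset> UNIV" using \<open>I \<noteq> UNIV\<close> by blast
  \<comment> \<open>Minimality is arranged by taking a convex ideal of least dimension above
    \<open>I\<close>.\<close>
  then obtain K where K: "convex_ideal r K" "I \<subset> K"
    and least: "\<And>J. convex_ideal r J \<Longrightarrow> I \<subset> J \<Longrightarrow> dim K \<le> dim J"
    using ex_has_least_nat[of "\<lambda>J. convex_ideal r J \<and> I \<subset> J" UNIV dim] by blast
  have min: "J = K" if "convex_ideal r J" "I \<subset> J" "J \<subseteq> K" for J
    using subspace_dim_equal[OF convex_idealD(2)[OF that(1)] convex_idealD(2)[OF K(1)]] that least
    by blast
  note idK = convex_idealD(1)[OF K(1)] and idI = convex_idealD(1)[OF I]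
  show ?thesis
  proof (cases "positives r \<inter> K \<subseteq> I")
    case True
    have "J = K" if J: "ideal J" "I \<subseteq> J" "J \<subseteq> K" "J \<noteq> I" for J
    proof (rule min)
      \<comment> \<open>Convexity of \<open>K\<close> puts \<open>a\<close> into \<open>K\<close>;
        being positive, it then lies in \<open>I\<close>, hence in \<open>J\<close>.\<close>
      have "a \<in> J" if "a + b \<in> J" "a \<in> positives r" "b \<in> positives r" for a b
        using that J convex_idealD(3)[OF K(1), of a b] True by blast
      then show "convex_ideal r J" using J(1) convex_ideal_iff[OF maximal_order_po_algebra] by blast
    qed (use J in auto)
    then have chief: "chief_factor K I" using chief_factor_iff[OF idI idK] K(2) by blast
    \<comment> \<open>A central factor would contain an element comparable to 0 outside
      \<open>I\<close>, contrary to the case assumption.\<close>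
    have noncentral: "\<not> central_factor K I"
    proof
      assume c: "central_factor K I"
      obtain z where z: "z \<in> K" "z \<notin> I" using K(2) by blast
      then have "z \<in> positives r \<or> - z \<in> positives r"
        using central_comparable[OF I z(2)] c central_factor_iff[OF sub] by blast
      then have "z \<in> I \<or> - z \<in> I"
        using True z(1) subspace_neg[OF idealD(1)[OF idK]] by blast
      then show False using z(2) subspace_neg[OF sub, of "- z"] by auto
    qed
    have "x +o I = y +o I" if xy: "x \<in> K" "y \<in> K" "(x +o I, y +o I) \<in> quotient_order r I" for x y
    proof -
      obtain i where i: "i \<in> I" "y - x + i \<in> positives r"
        using xy(3) quotient_order_iff[OF maximal_order_po_algebra sub] by blast
      have "y - x + i \<in> K"
        using xy(1,2) i(1) K(2) idealD(1)[OF idK] by (intro subspace_add subspace_diff) auto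
      then have "y - x + i \<in> I" using i(2) True by blast
      then have "y - x \<in> I" using subspace_diff[OF sub _ i(1)] by fastforce
      then show ?thesis using coset_eq_iff[OF sub] by metis
    qed
    moreover have "(x +o I, x +o I) \<in> quotient_order r I" for x
      using quotient_order_iff[OF maximal_order_po_algebra sub] positive_cone(1) subspace_0[OF sub] by force
    ultimately have "factor_order r K I = Id_on (factor K I)"
      by (auto simp: factor_order_def factor_def Id_on_def)
    then show ?thesis using K chief noncentral by (auto simp: adapted_factor_def)
  next
    case False
    \<comment> \<open>\<open>Z\<close> will be shown to contain every positive element of
      \<open>K\<close>. This makes it convex and larger than \<open>I\<close>, hence equal to
      \<open>K\<close>, so the factor is central.\<close>
    define Z where "Z = {x \<in> K. \<forall>y. x \<cdot> y \<in> I \<and> y \<cdot> x \<in> I}"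
    have IZ: "I \<subseteq> Z" using K(2) idealD[OF idI] by (auto simp: Z_def)
    have "subspace Z"
      unfolding subspace_def Z_def using idealD(1)[OF idK] sub
      by (auto simp: mult_simps subspace_def)
    then have "ideal Z"
      unfolding ideal_def using IZ by (auto simp: Z_def)
    have PZ: "a \<in> Z" if "a \<in> positives r" "a \<in> K" for a
    proof (cases "a \<in> I")
      case True
      then show ?thesis using IZ by blast
    next
      case a: False
      \<comment> \<open>\<open>L\<close> is a convex ideal between \<open>I\<close> and
        \<open>K\<close> that misses \<open>a\<close>, so it equals \<open>I\<close>; it also
        contains all products with \<open>a\<close>.\<close>
      define L where "L = infinitesimals a \<inter> K"
      have "convex_ideal r L"
        using convex_ideal_infinitesimals[OF that(1)] K(1)
        unfolding L_def convex_ideal_iff[OF maximal_order_po_algebra] using ideal_Int by blast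
      moreover have "I \<subseteq> L"
        using convex_ideal_subset_infinitesimals[OF I that(1) a] K(2) by (auto simp: L_def)
      moreover have "a \<notin> L"
        using not_mem_infinitesimals[OF that(1)] a subspace_0[OF sub] by (auto simp: L_def)
      ultimately have "L = I" using min[of L] that(2) by (auto simp: L_def)
      then show ?thesis
        using mult_mem_infinitesimals[OF that(1)] idealD(2,3)[OF idK that(2)] that(2)
        by (auto simp: L_def Z_def)
    qed
    have "convex_ideal r Z"
      unfolding convex_ideal_iff[OF maximal_order_po_algebra]
    proof (intro conjI allI impI \<open>ideal Z\<close>)
      fix a b assume ab: "a + b \<in> Z \<and> a \<in> positives r \<and> b \<in> positives r"
      then have "a \<in> K" using convex_idealD(3)[OF K(1), of a b] by (auto simp: Z_def)
      then show "a \<in> Z" using PZ ab by blast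
    qed
    moreover have "I \<subset> Z" using IZ False PZ by blast
    ultimately have "Z = K" by (intro min) (auto simp: Z_def)
    then have "central_factor K I" unfolding central_factor_iff[OF sub] by (auto simp: Z_def)
    then show ?thesis
      using linear_order_central_factor[OF I idK] K by (auto simp: adapted_factor_def)
  qed
qed

text \<open>By \<open>positive_add_convex_ideal\<close>, a correction by an element of
  \<open>S k\<close> does not affect the positivity of a difference outside
  \<open>S k\<close>.\<close>

lemma lexicographic_convex_series:
  assumes "\<And>j. j \<le> s \<Longrightarrow> convex_ideal r (S j)"
  shows "lexicographic r s S"
  unfolding lexicographic_def
proof (intro allI impI)
  fix x y k
  assume *: "x \<noteq> y \<and> k \<le> s \<and> x +o S k \<noteq> y +o S k \<and> (\<forall>j. k < j \<and> j \<le> s \<longrightarrow> x +o S j = y +o S j)"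
  then have I: "convex_ideal r (S k)" using assms by blast
  note sub = convex_idealD(2)[OF I]
  have xy: "y - x \<notin> S k" using * coset_eq_iff[OF sub] by metis
  have "(x, y) \<in> r" if i: "i \<in> S k" "y - x + i \<in> positives r" for i
  proof -
    have "y - x + i \<notin> S k" using xy i(1) subspace_diff[OF sub, of "y - x + i" i] by auto
    then have "(y - x + i) + (- i) \<in> positives r"
      using positive_add_convex_ideal[OF I i(2)] subspace_neg[OF sub i(1)] by blast
    then show ?thesis by (simp add: po_algebra_le_iff[OF maximal_order_po_algebra])
  qed
  moreover have "\<exists>i\<in>S k. y - x + i \<in> positives r" if "(x, y) \<in> r"
    using that subspace_0[OF sub] by (intro bexI[of _ 0]) (auto simp: po_algebra_le_iff[OF maximal_order_po_algebra])
  ultimately show "(x, y) \<in> r \<longleftrightarrow> (x +o S k, y +o S k) \<in> quotient_order r (S k)"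
    unfolding quotient_order_iff[OF maximal_order_po_algebra sub] by blast
qed

lemma ex_adapted_series: "\<exists>s S. adapted_series r s S"
proof -
  obtain f where f: "\<And>I. convex_ideal r I \<Longrightarrow> I \<noteq> UNIV \<Longrightarrow>
      convex_ideal r (f I) \<and> I \<subset> f I \<and> adapted_factor (f I) I"
    using ex_adapted_factor by metis
  define S where "S n = (f ^^ n) {0}" for n
  have S0: "S 0 = {0}" by (simp add: S_def)
  have SSuc: "S (Suc n) = f (S n)" for n by (simp add: S_def)
  have "ideal {0}" by (simp add: ideal_def subspace_def mult_simps)
  moreover have "a = 0" if "a + b = 0" "a \<in> positives r" "b \<in> positives r" for a b
    using positives_pointed[of a] that by (metis minus_unique)
  ultimately have conv0: "convex_ideal r {0}" unfolding convex_ideal_iff[OF maximal_order_po_algebra] by blast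
  \<comment> \<open>Nothing is known about \<open>f UNIV\<close>, so convexity is claimed only as
    long as the iteration has not passed \<open>UNIV\<close>.\<close>
  have conv: "convex_ideal r (S n)" if "\<And>j. j < n \<Longrightarrow> S j \<noteq> UNIV" for n
    using that
  proof (induction n)
    case 0
    then show ?case using S0 conv0 by simp
  next
    case (Suc n)
    then show ?case using f[of "S n"] by (simp add: SSuc)
  qed
  have "\<exists>n. S n = UNIV"
  proof (rule ccontr)
    assume "\<not> ?thesis"
    then have "S n \<subset> S (Suc n)" "subspace (S n)" for n
      using conv f convex_idealD(2) by (auto simp: SSuc)
    then have "dim (S n) < dim (S (Suc n))" for n
      by (intro dim_psubset) (simp add: span_eq_iff[THEN iffD2])
    then have "n \<le> dim (S n)" for n
      by (induction n) (auto intro: le_trans[OF _ Suc_leI])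
    then show False using dim_subset_UNIV[of "S (Suc dimension)"] not_less_eq_eq le_trans by blast
  qed
  \<comment> \<open>Stopping at the first occurrence of \<open>UNIV\<close> keeps all inclusions
    strict.\<close>
  define s where "s = (LEAST n. S n = UNIV)"
  have s: "S s = UNIV" unfolding s_def using \<open>\<exists>n. S n = UNIV\<close> by (rule LeastI_ex)
  have less: "S j \<noteq> UNIV" if "j < s" for j using not_less_Least that unfolding s_def by blast
  have conv': "convex_ideal r (S j)" if "j \<le> s" for j
    by (rule conv) (use that less in auto)
  have "adapted_series r s S"
    unfolding adapted_series_def
    using S0 s conv' lexicographic_convex_series[of s S] conv' f[of "S _"] less
    by (auto simp: SSuc adapted_factor_def)
  then show ?thesis by blast
qed

end

end

section \<open>Brackets, ideals and the derived series\<close>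

context fin_dim_lie_algebra
begin

lemma bracket_antisym: "bracket x y = - bracket y x"
proof -
  have "bracket (x + y) (x + y) = (bracket x x + bracket y x) + (bracket x y + bracket y y)"
    by (simp only: mult_simps)
  then have "bracket x y + bracket y x = 0" unfolding alternating by (simp add: add.commute)
  then show ?thesis by (rule eq_neg_iff_add_eq_0[THEN iffD2])
qed

text \<open>The Jacobi identity, read as compatibility of the adjoint action with brackets.\<close>

lemma bracket_bracket: "bracket (bracket x y) z = bracket x (bracket y z) - bracket y (bracket x z)"
proof -
  have "bracket z (bracket x y) = - bracket (bracket x y) z"
    "bracket y (bracket z x) = - bracket y (bracket x z)"
    using bracket_antisym[of z "bracket x y"] bracket_antisym[of z x] by (simp_all add: mult_simps)
  then show ?thesis using jacobi[of x y z] by (simp add: algebra_simps)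
qed

text \<open>The Jacobi identity as a Leibniz rule.\<close>

lemma bracket_commute: "bracket x (bracket y z) = bracket y (bracket x z) + bracket (bracket x y) z"
  by (simp add: bracket_bracket)

lemma linear_ad: "Vector_Spaces.linear scale scale (bracket x)"
  by (rule linear_right)

lemmas ad_simps = linear_endoE[OF linear_ad]
lemmas ad_pow_simps = linear_endoE[OF linear_endo_funpow[OF linear_ad]]

lemma ideal_iff: "ideal I \<longleftrightarrow> subspace I \<and> (\<forall>x\<in>I. \<forall>y. bracket y x \<in> I)"
proof -
  have "bracket x y \<in> I" if "subspace I" "bracket y x \<in> I" for x y
    using subspace_neg[OF that] bracket_antisym[of x y] by simp
  then show ?thesis unfolding ideal_def by blast
qed

lemma ad_pow_mem:
  assumes "\<And>m. m \<in> W \<Longrightarrow> bracket u m \<in> W" "m \<in> W"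
  shows "(bracket u ^^ k) m \<in> W"
  using assms by (induction k) auto

lemma bracket_mem_bracket_span: "x \<in> U \<Longrightarrow> y \<in> V \<Longrightarrow> bracket x y \<in> bracket_span U V"
  unfolding bracket_span_def by (rule span_base) blast

lemma bracket_span_subset:
  assumes "subspace W" "\<And>x y. x \<in> U \<Longrightarrow> y \<in> V \<Longrightarrow> bracket x y \<in> W"
  shows "bracket_span U V \<subseteq> W"
  unfolding bracket_span_def using assms by (intro span_minimal) auto

lemma ideal_bracket_span:
  assumes "ideal U" "ideal V"
  shows "ideal (bracket_span U V)"
proof -
  have sub: "subspace (bracket_span U V)" unfolding bracket_span_def by (rule subspace_span)
  have "bracket y x \<in> bracket_span U V" if x: "x \<in> bracket_span U V" for x y
  proof -
    have "bracket_span U V \<subseteq> {x. bracket y x \<in> bracket_span U V}"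
    proof (rule bracket_span_subset)
      show "subspace {x. bracket y x \<in> bracket_span U V}"
        using sub by (auto simp: subspace_def ad_simps)
      fix a b assume ab: "a \<in> U" "b \<in> V"
      have "bracket (bracket y a) b \<in> bracket_span U V" "bracket a (bracket y b) \<in> bracket_span U V"
        using ab idealD(3)[OF assms(1)] idealD(3)[OF assms(2)] bracket_mem_bracket_span by blast+
      then show "bracket a b \<in> {x. bracket y x \<in> bracket_span U V}"
        using subspace_add[OF sub] by (simp add: bracket_commute[of y a b])
    qed
    then show ?thesis using x by blast
  qed
  then show ?thesis using sub by (simp add: ideal_iff)
qed

abbreviation derived :: "nat \<Rightarrow> 'a set" where
  "derived n \<equiv> ((\<lambda>U. bracket_span U U) ^^ n) UNIV"

lemma ideal_derived: "ideal (derived n)"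
proof (induction n)
  case 0
  show ?case by (simp add: ideal_iff)
next
  case (Suc n)
  then show ?case using ideal_bracket_span by simp
qed

text \<open>For ideals \<open>I\<close> and \<open>J\<close> with \<open>I\<close> inside
  \<open>J\<close>, this is the kernel of the adjoint action on \<open>J/I\<close>.\<close>

definition annihilator :: "'a set \<Rightarrow> 'a set \<Rightarrow> 'a set" where
  "annihilator J I = {x. \<forall>m\<in>J. bracket x m \<in> I}"

lemma subspace_annihilator: "subspace I \<Longrightarrow> subspace (annihilator J I)"
  by (auto simp: annihilator_def subspace_def mult_simps)

section \<open>Commutators act trivially on an irreducible factor\<close>

context
  fixes J I
  assumes I: "ideal I" and J: "ideal J" and IJ: "I \<subset> J"
    and min: "\<And>K. ideal K \<Longrightarrow> I \<subset> K \<Longrightarrow> K \<subseteq> J \<Longrightarrow> K = J"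
begin

lemmas I_simps = idealD(2,3)[OF I] subspace_add[OF idealD(1)[OF I]] subspace_diff[OF idealD(1)[OF I]]
  subspace_scale[OF idealD(1)[OF I]] subspace_0[OF idealD(1)[OF I]]
lemmas J_simps = idealD(2,3)[OF J] subspace_add[OF idealD(1)[OF J]] subspace_diff[OF idealD(1)[OF J]]
  subspace_scale[OF idealD(1)[OF J]] subspace_0[OF idealD(1)[OF J]]

lemma annihilatorD: "x \<in> annihilator J I \<Longrightarrow> m \<in> J \<Longrightarrow> bracket x m \<in> I"
  by (simp add: annihilator_def)

text \<open>On \<open>J/I\<close> the commutator commutes with \<open>d\<close>, so
  \<open>commutator_not_injective_mod\<close> provides a nonzero kernel vector.\<close>

lemma commutator_kernel:
  assumes "bracket d (bracket a d) \<in> annihilator J I"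
  shows "\<exists>m\<in>J. m \<notin> I \<and> bracket (bracket a d) m \<in> I"
proof (rule commutator_not_injective_mod[OF linear_ad[of a] linear_ad[of d]])
  show "bracket d (bracket (bracket a d) m) - bracket (bracket a d) (bracket d m) \<in> I" if "m \<in> J" for m
    using annihilatorD[OF assms that] by (simp add: bracket_bracket[of d])
qed (use I J IJ in \<open>auto simp: bracket_bracket[of a d] idealD\<close>)

lemma commuting_ad_pow:
  assumes uv: "bracket u v \<in> annihilator J I" and m: "m \<in> J"
  shows "(bracket u ^^ n) (bracket v m) - bracket v ((bracket u ^^ n) m) \<in> I"
proof (induction n)
  case 0
  then show ?case using I_simps by simp
next
  case (Suc n)
  let ?m = "(bracket u ^^ n) m"
  have "?m \<in> J" using m J_simps by (intro ad_pow_mem)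
  have "(bracket u ^^ Suc n) (bracket v m) - bracket v ((bracket u ^^ Suc n) m)
      = bracket u ((bracket u ^^ n) (bracket v m) - bracket v ?m) + bracket (bracket u v) ?m"
    by (simp add: ad_simps bracket_bracket)
  then show ?case using Suc I_simps annihilatorD[OF uv \<open>?m \<in> J\<close>] by simp
qed

text \<open>The generalized null space of \<open>u\<close> on \<open>J/I\<close> is thus stable
  under all of \<open>A\<close>. Write \<open>u x m = x u m + v m\<close> with
  \<open>v = [u, x]\<close> in \<open>D\<close>: the first term is handled by induction, and
  \<open>v\<close> commutes with \<open>u\<close> on \<open>J/I\<close>. Applying \<open>x\<close>
  costs one extra power of \<open>u\<close>.\<close>

lemma ad_pow_submodule:
  assumes "ideal D" and DD: "\<forall>d\<in>D. \<forall>e\<in>D. bracket d e \<in> annihilator J I"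
    and u: "u \<in> D" and "m \<in> J" "(bracket u ^^ k) m \<in> I"
  shows "(bracket u ^^ Suc k) (bracket x m) \<in> I"
  using assms(4,5)
proof (induction k arbitrary: m)
  case 0
  then show ?case using I_simps by simp
next
  case (Suc k)
  define v where "v = bracket u x"
  have v: "v \<in> D" using u idealD[OF \<open>ideal D\<close>] by (simp add: v_def)
  have "(bracket u ^^ k) (bracket u m) \<in> I"
    using Suc.prems(2) by (simp add: funpow_Suc_right del: funpow.simps)
  then have 1: "(bracket u ^^ Suc k) (bracket x (bracket u m)) \<in> I"
    using Suc.IH Suc.prems(1) J_simps(2) by blast
  have "(bracket u ^^ Suc k) (bracket v m) - bracket v ((bracket u ^^ Suc k) m) \<in> I"
    using commuting_ad_pow DD[rule_format, OF u v] Suc.prems(1) by blast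
  moreover have "bracket v ((bracket u ^^ Suc k) m) \<in> I" using Suc.prems(2) I_simps(2) by blast
  ultimately have 2: "(bracket u ^^ Suc k) (bracket v m) \<in> I"
    using I_simps(3)[of "(bracket u ^^ Suc k) (bracket v m) - bracket v ((bracket u ^^ Suc k) m)"]
    by (metis diff_add_cancel)
  have "(bracket u ^^ Suc (Suc k)) (bracket x m)
      = (bracket u ^^ Suc k) (bracket x (bracket u m) + bracket v m)"
    by (simp add: funpow_Suc_right v_def bracket_commute[of u x m] del: funpow.simps)
  then show ?case using 1 2 I_simps(3) by (simp add: ad_pow_simps del: funpow.simps)
qed

text \<open>The generalized null space \<open>G\<close> is an ideal by
  \<open>ad_pow_submodule\<close> and exceeds \<open>I\<close> by \<open>commutator_kernel\<close>;
  minimality makes it all of \<open>J\<close>.\<close>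

lemma ad_locally_nilpotent:
  assumes D: "ideal D" and DD: "\<forall>d\<in>D. \<forall>e\<in>D. bracket d e \<in> annihilator J I"
    and d: "d \<in> D" and m: "m \<in> J"
  shows "\<exists>k. (bracket (bracket a d) ^^ k) m \<in> I"
proof -
  define u where "u = bracket a d"
  have u: "u \<in> D" using d idealD[OF D] by (simp add: u_def)
  define G where "G = {m \<in> J. \<exists>k. (bracket u ^^ k) m \<in> I}"
  have mono: "(bracket u ^^ l) m \<in> I" if "(bracket u ^^ k) m \<in> I" "k \<le> l" for k l m
  proof -
    have "(bracket u ^^ l) m = (bracket u ^^ (l - k)) ((bracket u ^^ k) m)"
      using that(2) funpow_add[of "l - k" k "bracket u"] by simp
    then show ?thesis using ad_pow_mem[of I u "(bracket u ^^ k) m"] that(1) I_simps(2) by simp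
  qed
  have "ideal G"
    unfolding ideal_iff
  proof (intro conjI ballI allI)
    show "subspace G"
      unfolding subspace_def
    proof (intro conjI ballI allI)
      have "(bracket u ^^ 0) 0 \<in> I" using I_simps(6) by simp
      then show "0 \<in> G" unfolding G_def using J_simps(6) by blast
      fix x assume "x \<in> G"
      then obtain k where x: "x \<in> J" "(bracket u ^^ k) x \<in> I" by (auto simp: G_def)
      then have "(bracket u ^^ k) (c *s x) \<in> I" for c using I_simps(5) by (simp add: ad_pow_simps)
      then show "c *s x \<in> G" for c unfolding G_def using J_simps(5)[OF x(1)] by blast
      fix y assume "y \<in> G"
      then obtain l where y: "y \<in> J" "(bracket u ^^ l) y \<in> I" by (auto simp: G_def)
      have "(bracket u ^^ max k l) (x + y) \<in> I"
        using mono[OF x(2), of "max k l"] mono[OF y(2), of "max k l"] I_simps(3)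
        by (simp add: ad_pow_simps)
      then show "x + y \<in> G" unfolding G_def using J_simps(3)[OF x(1) y(1)] by blast
    qed
    fix x y assume "x \<in> G"
    then obtain k where x: "x \<in> J" "(bracket u ^^ k) x \<in> I" by (auto simp: G_def)
    then have "(bracket u ^^ Suc k) (bracket y x) \<in> I" by (rule ad_pow_submodule[OF D DD u])
    then show "bracket y x \<in> G" unfolding G_def using J_simps(2)[OF x(1)] by blast
  qed
  moreover have "I \<subseteq> G"
  proof
    fix x assume "x \<in> I"
    then have "(bracket u ^^ 0) x \<in> I" by simp
    then show "x \<in> G" unfolding G_def using IJ \<open>x \<in> I\<close> by blast
  qed
  moreover have "\<exists>m\<in>G. m \<notin> I"
  proof -
    obtain m where m: "m \<in> J" "m \<notin> I" "bracket u m \<in> I"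
      using commutator_kernel[OF DD[rule_format, OF d u, unfolded u_def]] unfolding u_def by blast
    then have "(bracket u ^^ 1) m \<in> I" by simp
    then show ?thesis unfolding G_def using m by blast
  qed
  ultimately have "G = J" by (intro min) (auto simp: G_def)
  then show ?thesis using m by (auto simp: G_def u_def)
qed

text \<open>Nilpotence of each \<open>[a, d]\<close> is upgraded to a common kernel. On a minimal
  \<open>D\<close>-stable space \<open>N\<close> above \<open>I\<close>, the kernel of each
  \<open>[a, d]\<close> is again \<open>D\<close>-stable and larger than \<open>I\<close>, hence all
  of \<open>N\<close>. One \<open>N\<close> serves all \<open>a\<close> and \<open>d\<close>, and
  the common kernel \<open>K\<close> is an ideal.\<close>

lemma bracket_ideal_annihilates:
  assumes D: "ideal D" and DD: "\<forall>d\<in>D. \<forall>e\<in>D. bracket d e \<in> annihilator J I"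
    and d: "d \<in> D"
  shows "bracket a d \<in> annihilator J I"
proof -
  define stable where
    "stable N \<longleftrightarrow> subspace N \<and> I \<subset> N \<and> N \<subseteq> J \<and> (\<forall>e\<in>D. \<forall>n\<in>N. bracket e n \<in> N)" for N
  have "stable J" using IJ J by (auto simp: stable_def idealD)
  then obtain N where N: "stable N" and least: "\<And>N'. stable N' \<Longrightarrow> dim N \<le> dim N'"
    using ex_has_least_nat[of stable J dim] by blast
  have kill: "bracket (bracket a d) n \<in> I" if d: "d \<in> D" and n: "n \<in> N" for a d n
  proof -
    define u where "u = bracket a d"
    have u: "u \<in> D" using d idealD[OF D] by (simp add: u_def)
    define N' where "N' = {n \<in> N. bracket u n \<in> I}"
    have sub: "subspace N'"
      using N I_simps unfolding stable_def N'_def subspace_def by (auto simp: ad_simps)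
    have IN': "I \<subseteq> N'" using N I_simps by (auto simp: stable_def N'_def)
    have "bracket e n \<in> N'" if e: "e \<in> D" and n: "n \<in> N'" for e n
    proof -
      have nJ: "n \<in> J" "bracket u n \<in> I" "n \<in> N" using n N by (auto simp: N'_def stable_def)
      have "bracket u (bracket e n) \<in> I"
        using bracket_commute[of u e n] I_simps annihilatorD[OF DD[rule_format, OF u e] nJ(1)] nJ(2) by simp
      then show ?thesis using N e nJ(3) by (auto simp: N'_def stable_def)
    qed
    moreover have "I \<noteq> N'"
    proof -
      obtain n where n: "n \<in> N" "n \<notin> I" using N by (auto simp: stable_def)
      then have "\<exists>k. (bracket u ^^ k) n \<in> I"
        using ad_locally_nilpotent[OF D DD d, of n a] N by (auto simp: u_def stable_def)
      then obtain k where k: "(bracket u ^^ k) n \<in> I" "\<And>l. l < k \<Longrightarrow> (bracket u ^^ l) n \<notin> I"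
        using exists_least_iff[of "\<lambda>k. (bracket u ^^ k) n \<in> I"] by blast
      then obtain l where l: "k = Suc l" using n by (cases k) auto
      have "(bracket u ^^ l) n \<in> N" using N u n(1) by (intro ad_pow_mem) (auto simp: stable_def)
      then have "(bracket u ^^ l) n \<in> N'" using k(1) by (simp add: N'_def l)
      \<comment> \<open>The last power of \<open>u\<close> that does not send \<open>n\<close> into
        \<open>I\<close> gives an element of \<open>N'\<close> outside \<open>I\<close>.\<close>
      then show ?thesis using k(2)[of l] l by auto
    qed
    ultimately have "stable N'" using N sub IN' unfolding stable_def N'_def by blast
    then have "N' = N"
      using subspace_dim_equal[OF sub, of N] least N by (auto simp: N'_def stable_def)
    then show ?thesis using n by (auto simp: N'_def u_def)
  qed
  define K where "K = {m \<in> J. \<forall>a. \<forall>d\<in>D. bracket (bracket a d) m \<in> I}"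
  have "ideal K"
    unfolding ideal_iff
  proof (intro conjI ballI allI)
    show "subspace K"
      using I_simps J_simps unfolding K_def subspace_def by (auto simp: mult_simps)
    fix m x assume m: "m \<in> K"
    have "bracket (bracket b e) (bracket x m) \<in> I" if e: "e \<in> D" for b e
    proof -
      \<comment> \<open>As \<open>[b, e]\<close> is in \<open>D\<close>, the element
        \<open>[x, [b, e]]\<close> is also of the form that kills \<open>m\<close> modulo
        \<open>I\<close>.\<close>
      have "bracket b e \<in> D" using e idealD[OF D] by blast
      then have "bracket (bracket x (bracket b e)) m \<in> I" "bracket (bracket b e) m \<in> I"
        using m e by (auto simp: K_def)
      then have "bracket x (bracket (bracket b e) m) - bracket (bracket x (bracket b e)) m \<in> I"
        using I_simps(2,4) by blast
      then show ?thesis by (simp add: bracket_bracket[of x "bracket b e"])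
    qed
    then show "bracket x m \<in> K" using m J_simps by (auto simp: K_def)
  qed
  moreover have "N \<subseteq> K" using N kill by (auto simp: K_def stable_def)
  ultimately have "K = J" using N by (intro min) (auto simp: K_def stable_def)
  then show ?thesis using d by (auto simp: annihilator_def K_def)
qed

text \<open>An argument as in Schur's lemma: \<open>[b, c]\<close> acts centrally on
  \<open>J/I\<close>, so its kernel is an ideal, and that kernel is nonzero by
  \<open>commutator_kernel\<close>.\<close>

lemma central_commutator_annihilates:
  assumes u: "\<And>x. bracket x (bracket b c) \<in> annihilator J I"
  shows "bracket b c \<in> annihilator J I"
proof -
  define K where "K = {m \<in> J. bracket (bracket b c) m \<in> I}"
  have "ideal K"
    unfolding ideal_iff
  proof (intro conjI ballI allI)
    show "subspace K"
      using I_simps J_simps unfolding K_def subspace_def by (auto simp: ad_simps)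
    fix m x assume m: "m \<in> K"
    have "bracket x (bracket (bracket b c) m) - bracket (bracket x (bracket b c)) m \<in> I"
      using m annihilatorD[OF u] I_simps by (auto simp: K_def)
    then show "bracket x m \<in> K"
      using m J_simps by (auto simp: K_def bracket_bracket[of x "bracket b c"])
  qed
  moreover have "I \<subseteq> K" using IJ I_simps by (auto simp: K_def)
  moreover have "\<exists>m\<in>K. m \<notin> I" using commutator_kernel[OF u] by (auto simp: K_def)
  ultimately have "K = J" by (intro min) (auto simp: K_def)
  then show ?thesis by (auto simp: K_def annihilator_def)
qed

text \<open>Induction down the derived series. If \<open>[D, D]\<close> acts trivially for
  \<open>D = derived (Suc n)\<close>, then \<open>[A, D]\<close> acts trivially, so the commutators
  generating \<open>D\<close> act centrally and hence trivially.\<close>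

lemma commutators_annihilate_chief_factor:
  assumes solvable
  shows "bracket x y \<in> annihilator J I"
proof -
  note sub = subspace_annihilator[OF idealD(1)[OF I], of J]
  have step: "derived (Suc n) \<subseteq> annihilator J I"
    if n: "derived (Suc (Suc n)) \<subseteq> annihilator J I" for n
  proof -
    have "\<forall>d\<in>derived (Suc n). \<forall>e\<in>derived (Suc n). bracket d e \<in> annihilator J I"
      using n bracket_mem_bracket_span[of _ "derived (Suc n)" _ "derived (Suc n)"] by auto
    note * = bracket_ideal_annihilates[OF ideal_derived this]
    have "bracket b c \<in> annihilator J I" if "b \<in> derived n" "c \<in> derived n" for b c
    proof -
      have "bracket b c \<in> derived (Suc n)" using bracket_mem_bracket_span[OF that] by simp
      then show ?thesis using central_commutator_annihilates * by blast
    qed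
    then show ?thesis using bracket_span_subset[OF sub] by simp
  qed
  obtain n where "derived n = {0}" using assms by (auto simp: solvable_def)
  \<comment> \<open>The start is one index later because \<open>step\<close> runs through successor
    indices and ends at \<open>derived (Suc 0)\<close>.\<close>
  then have "derived (Suc n) \<subseteq> annihilator J I"
    using bracket_span_subset[OF sub, of "{0}" "{0}"] subspace_0[OF sub] by (simp add: mult_simps)
  then have "derived (Suc 0) \<subseteq> annihilator J I"
    by (induction n) (use step in blast)+
  then show ?thesis using bracket_mem_bracket_span[of x UNIV y UNIV] by auto
qed

end

end

section \<open>Fitting null components and nilpotent subalgebras\<close>

context fin_dim_lie_algebra
begin

definition fitting_null :: "'a \<Rightarrow> 'a set" where
  "fitting_null h = {x. \<exists>n. (bracket h ^^ n) x = 0}"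

lemma ad_pow_eq_0_mono:
  assumes "(bracket h ^^ n) x = 0" "n \<le> m"
  shows "(bracket h ^^ m) x = 0"
proof -
  have "(bracket h ^^ m) x = (bracket h ^^ (m - n)) ((bracket h ^^ n) x)"
    using assms(2) funpow_add[of "m - n" n "bracket h"] by simp
  then show ?thesis using assms(1) by (simp add: ad_pow_simps)
qed

text \<open>By the Leibniz rule each application of \<open>ad h\<close> hits \<open>x\<close> or
  \<open>y\<close> and lowers one of the two exponents; at exponent 0 the bracket vanishes.\<close>

lemma ad_pow_bracket_eq_0:
  "(bracket h ^^ m) x = 0 \<Longrightarrow> (bracket h ^^ n) y = 0 \<Longrightarrow> (bracket h ^^ (m + n)) (bracket x y) = 0"
proof (induction "m + n" arbitrary: m n x y)
  case 0
  then show ?case by (simp add: mult_simps)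
next
  case (Suc k)
  show ?case
  proof (cases "m = 0 \<or> n = 0")
    case True
    then have "bracket x y = 0" using Suc.prems by (auto simp: mult_simps)
    then show ?thesis by (simp add: ad_pow_simps)
  next
    case False
    then obtain m' n' where mn: "m = Suc m'" "n = Suc n'" by (metis not0_implies_Suc)
    have "(bracket h ^^ (m' + n)) (bracket (bracket h x) y) = 0"
      using Suc.hyps(1)[of m' n "bracket h x" y] Suc.hyps(2) Suc.prems mn
      by (simp add: funpow_Suc_right del: funpow.simps)
    moreover have "(bracket h ^^ (m + n')) (bracket x (bracket h y)) = 0"
      using Suc.hyps(1)[of m n' x "bracket h y"] Suc.hyps(2) Suc.prems mn
      by (simp add: funpow_Suc_right del: funpow.simps)
    moreover have "m + n = Suc (m' + n)" "m + n' = m' + n" using mn by auto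
    ultimately show ?thesis
      by (simp add: funpow_Suc_right bracket_commute[of h x y] ad_pow_simps del: funpow.simps)
  qed
qed

lemma subalgebra_fitting_null: "subalgebra (fitting_null h)"
  unfolding subalgebra_def subspace_def
proof (intro conjI ballI allI)
  show "0 \<in> fitting_null h" by (auto simp: fitting_null_def ad_pow_simps)
  fix x assume "x \<in> fitting_null h"
  then obtain m where m: "(bracket h ^^ m) x = 0" by (auto simp: fitting_null_def)
  then show "c *s x \<in> fitting_null h" for c by (auto simp: fitting_null_def ad_pow_simps intro!: exI[of _ m])
  fix y assume "y \<in> fitting_null h"
  then obtain n where n: "(bracket h ^^ n) y = 0" by (auto simp: fitting_null_def)
  have "(bracket h ^^ max m n) (x + y) = 0"
    using ad_pow_eq_0_mono[OF m, of "max m n"] ad_pow_eq_0_mono[OF n, of "max m n"]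
    by (simp add: ad_pow_simps)
  then show "x + y \<in> fitting_null h" unfolding fitting_null_def by blast
  show "bracket x y \<in> fitting_null h"
    using ad_pow_bracket_eq_0[OF m n] unfolding fitting_null_def by blast
qed

lemma mem_fitting_null_self: "h \<in> fitting_null h"
  by (auto simp: fitting_null_def alternating intro: exI[of _ 1])

text \<open>Since \<open>h\<close> lies in its own null component, an element \<open>x\<close> of
  the normalizer has \<open>[h, x]\<close> there, and one more power of \<open>ad h\<close> kills
  \<open>x\<close>.\<close>

lemma normalizer_fitting_null: "normalizer (fitting_null h) = fitting_null h"
proof
  show "fitting_null h \<subseteq> normalizer (fitting_null h)"
    using subalgebra_fitting_null by (auto simp: normalizer_def subalgebra_def)
  show "normalizer (fitting_null h) \<subseteq> fitting_null h"
  proof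
    fix x assume "x \<in> normalizer (fitting_null h)"
    then have "bracket x h \<in> fitting_null h" using mem_fitting_null_self by (simp add: normalizer_def)
    then have "bracket h x \<in> fitting_null h"
      using bracket_antisym[of h x] subalgebra_fitting_null subspace_neg by (simp add: subalgebra_def)
    then obtain n where "(bracket h ^^ n) (bracket h x) = 0" by (auto simp: fitting_null_def)
    then have "(bracket h ^^ Suc n) x = 0" by (simp add: funpow_Suc_right del: funpow.simps)
    then show "x \<in> fitting_null h" unfolding fitting_null_def by blast
  qed
qed

text \<open>The powers of \<open>ad h\<close> descend the lower central series of
  \<open>H\<close>.\<close>

lemma nilpotent_subset_fitting_null:
  assumes "nilpotent H" "h \<in> H"
  shows "H \<subseteq> fitting_null h"
proof
  fix x assume x: "x \<in> H"
  have "(bracket h ^^ n) x \<in> (bracket_span H ^^ n) H" for n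
    by (induction n) (use x assms(2) bracket_mem_bracket_span in auto)
  then show "x \<in> fitting_null h" using assms(1) by (force simp: nilpotent_def fitting_null_def)
qed

lemma annihilator_eq_UNIV_iff:
  assumes "ideal I"
  shows "annihilator J I = UNIV \<longleftrightarrow> central_factor J I"
proof -
  have "bracket y x \<in> I \<longleftrightarrow> bracket x y \<in> I" for x y
    using bracket_antisym[of x y] bracket_antisym[of y x] subspace_neg[OF idealD(1)[OF assms]] by metis
  then show ?thesis
    unfolding central_factor_iff[OF idealD(1)[OF assms]] annihilator_def by blast
qed

section \<open>Cartan subalgebras along a series with central or chief factors\<close>

context
  fixes s :: nat and S :: "nat \<Rightarrow> 'a set"
  assumes solvable: solvable
    and S_0: "S 0 = {0}" and S_last: "S s = UNIV"
    and ideal_S: "\<And>j. j \<le> s \<Longrightarrow> ideal (S j)"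
    and S_less: "\<And>j. j < s \<Longrightarrow> S j \<subset> S (Suc j)"
    and S_factor: "\<And>j. j < s \<Longrightarrow> central_factor (S (Suc j)) (S j) \<or> chief_factor (S (Suc j)) (S j)"
begin

lemma subspace_S: "j \<le> s \<Longrightarrow> subspace (S j)"
  using ideal_S idealD(1) by blast

lemma chief_minimal:
  assumes j: "j < s" "\<not> central_factor (S (Suc j)) (S j)"
    and K: "ideal K" "S j \<subset> K" "K \<subseteq> S (Suc j)"
  shows "K = S (Suc j)"
  using S_factor[OF j(1)] j(2) chief_factor_iff[of "S j" "S (Suc j)"] ideal_S[of j] ideal_S[of "Suc j"]
    S_less[OF j(1)] j(1) K by auto

lemma commutator_mem_annihilator:
  assumes "j < s"
  shows "bracket x y \<in> annihilator (S (Suc j)) (S j)"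
proof (cases "central_factor (S (Suc j)) (S j)")
  case True
  then show ?thesis using annihilator_eq_UNIV_iff[OF ideal_S, of j] assms by auto
next
  case False
  show ?thesis
    by (rule commutators_annihilate_chief_factor[OF ideal_S ideal_S S_less _ solvable])
      (use assms chief_minimal[OF assms False] in auto)
qed

text \<open>As \<open>[h, y]\<close> acts trivially for every \<open>y\<close>, the kernel of
  \<open>h\<close> on the factor is an ideal; it is proper, so minimality makes it zero.\<close>

lemma ad_injective_on_chief_factor:
  assumes j: "j < s" and h: "h \<notin> annihilator (S (Suc j)) (S j)"
    and x: "x \<in> S (Suc j)" "bracket h x \<in> S j"
  shows "x \<in> S j"
proof -
  have noncentral: "\<not> central_factor (S (Suc j)) (S j)"
    using annihilator_eq_UNIV_iff[OF ideal_S, of j] j h by auto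
  note I = ideal_S[of j] and J = ideal_S[of "Suc j"]
  define K where "K = {m \<in> S (Suc j). bracket h m \<in> S j}"
  have "ideal K"
    unfolding ideal_iff
  proof (intro conjI ballI allI)
    show "subspace K"
      using subspace_S[of j] subspace_S[of "Suc j"] j
      by (auto simp: K_def subspace_def ad_simps)
    fix m y assume m: "m \<in> K"
    have "bracket y (bracket h m) \<in> S j" using m idealD(3)[OF I] j by (auto simp: K_def)
    moreover have "bracket (bracket h y) m \<in> S j"
      using commutator_mem_annihilator[OF j, of h y] m by (auto simp: K_def annihilator_def)
    ultimately show "bracket y m \<in> K"
      using m idealD(3)[OF J] j subspace_add[OF subspace_S[of j]]
      by (auto simp: K_def bracket_commute[of h y m])
  qed
  moreover have "S j \<subseteq> K" using S_less[OF j] idealD(3)[OF I] j by (auto simp: K_def)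
  moreover have "K \<noteq> S (Suc j)" using h by (auto simp: K_def annihilator_def)
  ultimately have "K = S j" using chief_minimal[OF j noncentral, of K] by (auto simp: K_def)
  then show ?thesis using x by (auto simp: K_def)
qed

lemma fitting_null_Int_chief:
  assumes j: "j < s" and h: "h \<notin> annihilator (S (Suc j)) (S j)"
    and x: "x \<in> fitting_null h" "x \<in> S (Suc j)"
  shows "x \<in> S j"
proof -
  have "x \<in> S j" if "(bracket h ^^ n) x = 0" "x \<in> S (Suc j)" for n
    using that
  proof (induction n arbitrary: x)
    case 0
    then show ?case using subspace_0[OF subspace_S] j by simp
  next
    case (Suc n)
    have "bracket h x \<in> S j"
      using Suc.IH[of "bracket h x"] Suc.prems idealD(3)[OF ideal_S] j
      by (simp add: funpow_Suc_right del: funpow.simps)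
    then show ?case using ad_injective_on_chief_factor[OF j h] Suc.prems by blast
  qed
  then show ?thesis using x by (auto simp: fitting_null_def)
qed

text \<open>Either \<open>x\<close> already lies in the lower term because \<open>h\<close> is
  injective on the factor, or \<open>y\<close> acts as zero there. Brackets therefore descend one
  step of the series.\<close>

lemma bracket_fitting_null_mem:
  assumes j: "j < s"
    and h: "h \<notin> annihilator (S (Suc j)) (S j) \<or> y \<in> annihilator (S (Suc j)) (S j)"
    and x: "x \<in> fitting_null h" "x \<in> S (Suc j)"
  shows "bracket y x \<in> S j"
  using h
proof
  assume "h \<notin> annihilator (S (Suc j)) (S j)"
  then have "x \<in> S j" using fitting_null_Int_chief j x by blast
  then show ?thesis using idealD(3)[OF ideal_S] j by simp
qed (use x in \<open>simp add: annihilator_def\<close>)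

text \<open>The dimension is counted factor by factor. A noncentral factor contributes nothing by
  \<open>fitting_null_Int_chief\<close>. On a central one \<open>ad h\<close> maps into
  \<open>S j\<close>, so the Fitting decomposition shows that the null component covers the whole
  factor.\<close>

lemma dim_fitting_null:
  assumes h: "\<And>j. j < s \<Longrightarrow> \<not> central_factor (S (Suc j)) (S j) \<Longrightarrow> h \<notin> annihilator (S (Suc j)) (S j)"
  shows "dim (fitting_null h) = central_dim s S"
proof -
  let ?B = "fitting_null h"
  have subB: "subspace ?B" using subalgebra_fitting_null by (simp add: subalgebra_def)
  have step: "dim (?B \<inter> S (Suc j)) = dim (?B \<inter> S j)
      + (if central_factor (S (Suc j)) (S j) then factor_dim (S (Suc j)) (S j) else 0)"
    if j: "j < s" for j
  proof (cases "central_factor (S (Suc j)) (S j)")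
    case False
    then have "?B \<inter> S (Suc j) = ?B \<inter> S j"
      using fitting_null_Int_chief[OF j h[OF j False]] S_less[OF j] by blast
    then show ?thesis using False by simp
  next
    case True
    note sub = subspace_S[of j] subspace_S[of "Suc j"]
    have T: "bracket h x \<in> S j" if "x \<in> S (Suc j)" for x
      using True that central_factor_iff[OF sub(1)] j by auto
    have "{x + y |x y. x \<in> ?B \<inter> S (Suc j) \<and> y \<in> S j} = S (Suc j)"
    proof
      show "{x + y |x y. x \<in> ?B \<inter> S (Suc j) \<and> y \<in> S j} \<subseteq> S (Suc j)"
        using subspace_add[OF sub(2)] S_less[OF j] j by auto
      show "S (Suc j) \<subseteq> {x + y |x y. x \<in> ?B \<inter> S (Suc j) \<and> y \<in> S j}"
      proof
        fix x assume x: "x \<in> S (Suc j)"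
        have "bracket h z \<in> S (Suc j)" if "z \<in> S (Suc j)" for z
          using that idealD(3)[OF ideal_S] j by simp
        then obtain b y n where "b \<in> S (Suc j)" "(bracket h ^^ n) b = 0" "y \<in> S (Suc j)" "x = b + bracket h y"
          using fitting_decomposition[OF linear_ad sub(2) _ x, of h] j by auto
        then show "x \<in> {x + y |x y. x \<in> ?B \<inter> S (Suc j) \<and> y \<in> S j}"
          using T unfolding fitting_null_def by blast
      qed
    qed
    moreover have "(?B \<inter> S (Suc j)) \<inter> S j = ?B \<inter> S j" using S_less[OF j] by blast
    ultimately have "dim (S (Suc j)) + dim (?B \<inter> S j) = dim (?B \<inter> S (Suc j)) + dim (S j)"
      using dim_sums_Int[OF subspace_inter[OF subB sub(2)] sub(1)] j by simp
    moreover have "dim (S j) \<le> dim (S (Suc j))" using S_less[OF j] by (intro dim_subset) auto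
    ultimately show ?thesis using True by (simp add: factor_dim_def)
  qed
  have "dim (?B \<inter> S k)
      = (\<Sum>j | j < k \<and> central_factor (S (Suc j)) (S j). factor_dim (S (Suc j)) (S j))" if "k \<le> s" for k
    using that
  proof (induction k)
    case 0
    have "?B \<inter> {0} = {0}" using subspace_0[OF subB] by auto
    then show ?case using S_0 by simp
  next
    case (Suc k)
    have "{j. j < Suc k \<and> central_factor (S (Suc j)) (S j)}
        = (if central_factor (S (Suc k)) (S k) then {k} else {})
          \<union> {j. j < k \<and> central_factor (S (Suc j)) (S j)}"
      by (auto simp: less_Suc_eq)
    then show ?case using Suc step[of k] by simp
  qed
  from this[of s] show ?thesis by (simp add: S_last central_dim_def)
qed

text \<open>A generic \<open>h\<close> in \<open>H\<close> acts nontrivially on every factor on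
  which \<open>H\<close> does.\<close>

lemma ex_avoiding_annihilators:
  assumes "subspace H"
  shows "\<exists>h\<in>H. \<forall>j<s. \<not> H \<subseteq> annihilator (S (Suc j)) (S j) \<longrightarrow> h \<notin> annihilator (S (Suc j)) (S j)"
proof -
  define F where "F = (\<lambda>j. annihilator (S (Suc j)) (S j)) ` {j. j < s \<and> \<not> H \<subseteq> annihilator (S (Suc j)) (S j)}"
  have "\<exists>h\<in>H. \<forall>C\<in>F. h \<notin> C"
    by (rule ex_avoiding_subspaces[OF infinite_UNIV_char_0 assms])
      (auto simp: F_def intro!: subspace_annihilator subspace_S)
  then show ?thesis by (auto simp: F_def)
qed

text \<open>The null component of an \<open>h\<close> that is generic in the whole algebra is
  self-normalizing in any case; genericity makes it nilpotent.\<close>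

lemma ex_cartan_subalgebra: "\<exists>H. cartan_subalgebra H"
proof -
  obtain h where h: "\<And>j. j < s \<Longrightarrow>
      h \<notin> annihilator (S (Suc j)) (S j) \<or> annihilator (S (Suc j)) (S j) = UNIV"
    using ex_avoiding_annihilators[OF subspace_UNIV] by blast
  let ?B = "fitting_null h"
  have sub: "subspace ?B" "\<And>x y. x \<in> ?B \<Longrightarrow> y \<in> ?B \<Longrightarrow> bracket x y \<in> ?B"
    using subalgebra_fitting_null by (auto simp: subalgebra_def)
  \<comment> \<open>Each term of the lower central series lies one step further down the series
    \<open>S\<close>.\<close>
  have "(bracket_span ?B ^^ k) ?B \<subseteq> ?B \<inter> S (s - k) \<and> subspace ((bracket_span ?B ^^ k) ?B)" if "k \<le> s" for k
    using that
  proof (induction k)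
    case 0
    then show ?case using S_last sub by simp
  next
    case (Suc k)
    define j where "j = s - Suc k"
    have j: "j < s" "s - k = Suc j" using Suc.prems by (auto simp: j_def)
    have "bracket_span ?B ((bracket_span ?B ^^ k) ?B) \<subseteq> ?B \<inter> S j"
    proof (rule bracket_span_subset)
      show "subspace (?B \<inter> S j)" using sub(1) subspace_S j by (intro subspace_inter) auto
      fix y x assume "y \<in> ?B" "x \<in> (bracket_span ?B ^^ k) ?B"
      moreover from this have "x \<in> ?B" "x \<in> S (Suc j)" using Suc j by auto
      ultimately show "bracket y x \<in> ?B \<inter> S j"
        using sub(2) bracket_fitting_null_mem[OF j(1), of h y x] h[OF j(1)] by blast
    qed
    moreover have "subspace (bracket_span ?B U)" for U
      unfolding bracket_span_def by (rule subspace_span)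
    ultimately show ?case by (simp add: j_def)
  qed
  from this[of s] have "(bracket_span ?B ^^ s) ?B = {0}" using S_0 subspace_0 by auto
  then show ?thesis
    unfolding cartan_subalgebra_def nilpotent_def
    using subalgebra_fitting_null normalizer_fitting_null by blast
qed

lemma dim_cartan_subalgebra:
  assumes "cartan_subalgebra H"
  shows "dim H = central_dim s S"
proof -
  have H: "subspace H" "nilpotent H" "normalizer H = H"
    using assms by (auto simp: cartan_subalgebra_def subalgebra_def)
  obtain h where h: "h \<in> H" "\<And>j. j < s \<Longrightarrow>
      H \<subseteq> annihilator (S (Suc j)) (S j) \<or> h \<notin> annihilator (S (Suc j)) (S j)"
    using ex_avoiding_annihilators[OF H(1)] by blast
  let ?B = "fitting_null h"
  have HB: "H \<subseteq> ?B" using nilpotent_subset_fitting_null H(2) h(1) .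
  \<comment> \<open>Climbing the series: for \<open>x\<close> in the next layer, bracketing with
    \<open>H\<close> lands in the previous layer, hence in \<open>H\<close>, so \<open>x\<close>
    normalizes \<open>H\<close> and belongs to it.\<close>
  have "?B \<inter> S j \<subseteq> H" if "j \<le> s" for j
    using that
  proof (induction j)
    case 0
    then show ?case using S_0 subspace_0[OF H(1)] by auto
  next
    case (Suc j)
    then have j: "j < s" by simp
    show ?case
    proof
      fix x assume x: "x \<in> ?B \<inter> S (Suc j)"
      have "bracket x y \<in> H" if y: "y \<in> H" for y
      proof -
        have "bracket y x \<in> S j" using bracket_fitting_null_mem[OF j, of h y x] h(2)[OF j] x y by auto
        moreover have "bracket y x \<in> ?B"
          using subalgebra_fitting_null HB x y by (auto simp: subalgebra_def)
        ultimately have "bracket y x \<in> H" using Suc by auto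
        then show ?thesis using subspace_neg[OF H(1)] bracket_antisym[of x y] by simp
      qed
      then show "x \<in> H" using H(3) by (auto simp: normalizer_def)
    qed
  qed
  from this[of s] have eq: "?B = H" using HB S_last by auto
  \<comment> \<open>If \<open>h\<close> acted as zero, so would all of \<open>H\<close> by the
    choice of \<open>h\<close>. Commutators act as zero anyway and \<open>A = H + [h, A]\<close>, so
    the factor would be central.\<close>
  have "h \<notin> annihilator (S (Suc j)) (S j)"
    if j: "j < s" and noncentral: "\<not> central_factor (S (Suc j)) (S j)" for j
  proof
    assume "h \<in> annihilator (S (Suc j)) (S j)"
    then have HC: "H \<subseteq> annihilator (S (Suc j)) (S j)" using h(2)[OF j] by blast
    have "x \<in> annihilator (S (Suc j)) (S j)" for x
    proof -
      obtain b y n where "(bracket h ^^ n) b = 0" "x = b + bracket h y"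
        using fitting_decomposition[OF linear_ad subspace_UNIV, of h x] by auto
      moreover from this have "b \<in> H" unfolding eq[symmetric] fitting_null_def by blast
      ultimately show ?thesis
        using HC commutator_mem_annihilator[OF j, of h y] j
          subspace_add[OF subspace_annihilator[OF subspace_S[of j]]] by auto
    qed
    then show False using annihilator_eq_UNIV_iff[OF ideal_S, of j] j noncentral by auto
  qed
  then show ?thesis using dim_fitting_null[of h] eq by simp
qed

end

lemma adapted_series_cartan:
  assumes "solvable" "adapted_series r s S"
  shows "\<exists>H. cartan_subalgebra H" "cartan_subalgebra H \<Longrightarrow> dim H = central_dim s S"
proof -
  have S: "S 0 = {0}" "S s = UNIV" "\<And>j. j \<le> s \<Longrightarrow> ideal (S j)" "\<And>j. j < s \<Longrightarrow> S j \<subset> S (Suc j)"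
    using assms(2) by (auto simp: adapted_series_def convex_ideal_def)
  have factor: "central_factor (S (Suc j)) (S j) \<or> chief_factor (S (Suc j)) (S j)" if "j < s" for j
    using assms(2) that unfolding adapted_series_def by metis
  note S = S factor
  show "\<exists>H. cartan_subalgebra H" using assms(1) S by (rule ex_cartan_subalgebra)
  show "dim H = central_dim s S" if "cartan_subalgebra H"
    using assms(1) S that by (rule dim_cartan_subalgebra)
qed

text \<open>One Cartan subalgebra \<open>H\<close> fixes the value: every adapted series of every
  maximal order has \<open>central_dim\<close> equal to \<open>dim H\<close>. This gives
  independence of the series, of the order and of \<open>H\<close> at once.\<close>

lemma partial_order_rank_eq_rank:
  assumes solvable
  shows "\<exists>n. is_partial_order_rank n \<and> is_rank n"
proof -
  obtain r where r: "maximal_order r" using ex_maximal_order by blast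
  obtain s S where S: "adapted_series r s S" using ex_adapted_series[OF r] by blast
  obtain H where H: "cartan_subalgebra H" using adapted_series_cartan(1)[OF assms S] by blast
  have "is_rank (dim H)"
    unfolding is_rank_def using H adapted_series_cartan(2)[OF assms S] by auto
  moreover have "is_partial_order_rank (dim H)"
    unfolding is_partial_order_rank_def is_rank_of_order_def
    using r ex_adapted_series adapted_series_cartan(2)[OF assms _ H] by auto
  ultimately show ?thesis by blast
qed

end

theorem theorem3p27:
  fixes scale :: "'f::linordered_field \<Rightarrow> 'a::ab_group_add \<Rightarrow> 'a"
    and Basis :: "'a set"
    and bracket :: "'a \<Rightarrow> 'a \<Rightarrow> 'a"
  assumes "fin_dim_lie_algebra scale Basis bracket"
    and "fin_dim_lie_algebra.solvable scale bracket"
  shows "\<exists>n. fin_dim_algebra.is_partial_order_rank scale bracket n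
           \<and> fin_dim_lie_algebra.is_rank scale bracket n"
  using fin_dim_lie_algebra.partial_order_rank_eq_rank[OF assms] .

end
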